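(* Let $R$ be a commutative ring with unity such that $\frac12\in R$. Let $X$ be a connected finite poset with $|X|>2$ and let $\mathcal I=I(X,R)$ be the incidence algebra of $X$ over $R$. The following statements are equivalent: (i) Any two edges in $E(\Gamma(X))$ are contained in one cycle. (ii) For all $R$-linear maps $F_1,F_2,F_3,F_4:\mathcal I\to\mathcal I$ satisfying $$F_1(f)g+fF_2(g)+F_3(g)f+gF_4(f)=0\quad\text{whenever } f,g\in\mathcal I \text{ and } fg=gf=0,$$ there exist $C_1,C_2,C_3,C_4\in\mathcal I$, derivations $D_1,D_2:\mathcal I\to\mathcal I$, and $R$-linear central-valued maps $\Omega_1,\Omega_2:\mathcal I\to Z(\mathcal I)$ such that for all $f\in\mathcal I$ $$\begin{aligned}F_1(f)&=C_1f+D_1(f)+\Omega_1(f),\\ F_2(f)&=fC_2+D_1(f)+\Omega_2(f),\\ F_3(f)&=C_3f+D_2(f)-\Omega_2(f),\\ F_4(f)&=fC_4+D_2(f)-\Omega_1(f).\end{aligned}$$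
   Context: The comparability graph $\Gamma(X)$ of a finite poset $X$ is the simple undirected graph with vertex set $X$ in which distinct $x,y$ are adjacent (written $x\sim y$) iff $x<y$ or $y<x$; $E(\Gamma(X))$ is its edge set. $X$ is connected if $\Gamma(X)$ is connected. A cycle in $\Gamma(X)$ consists of distinct vertices $x_1,\dots,x_n$, $n\ge3$, with $x_1\sim x_2$, ..., $x_{n-1}\sim x_n$, $x_n\sim x_1$; it contains the edges $\{x_{i-1},x_i\}$ (indices modulo $n$). The incidence algebra $I(X,R)$ is the $R$-module of functions $f:X\times X\to R$ with $f(x,y)=0$ if $x\nleq y$, with multiplication $(fg)(x,y)=\sum_{x\le z\le y}f(x,z)g(z,y)$. $Z(\mathcal I)$ denotes the center of $\mathcal I$. A derivation is an $R$-linear map $D:\mathcal I\to\mathcal I$ with $D(fg)=D(f)g+fD(g)$ for all $f,g\in\mathcal I$. *)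

theory Defs
  imports Complex_Main
begin

text \<open>A finite poset is a type of class \<open>{finite, order}\<close>; the coefficient ring is a type of
  class \<open>comm_ring_1\<close>, which includes \<open>0 \<noteq> 1\<close>.\<close>

section \<open>The comparability graph\<close>

text \<open>A simple graph on the whole vertex type is given by its adjacency relation, assumed
  symmetric and irreflexive.\<close>

definition comparability :: "'x::order \<Rightarrow> 'x \<Rightarrow> bool"
  where "comparability x y \<longleftrightarrow> x < y \<or> y < x"

definition graph_edges :: "('a \<Rightarrow> 'a \<Rightarrow> bool) \<Rightarrow> 'a set set"
  where "graph_edges E = {{x, y} | x y. E x y}"

definition graph_connected :: "('a \<Rightarrow> 'a \<Rightarrow> bool) \<Rightarrow> bool"
  where "graph_connected E \<longleftrightarrow> (\<forall>x y. E\<^sup>*\<^sup>* x y)"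

definition graph_cycle :: "('a \<Rightarrow> 'a \<Rightarrow> bool) \<Rightarrow> 'a list \<Rightarrow> bool"
  where "graph_cycle E xs \<longleftrightarrow> distinct xs \<and> 3 \<le> length xs \<and>
    (\<forall>i < length xs. E (xs ! i) (xs ! (Suc i mod length xs)))"

definition cycle_edges :: "'a list \<Rightarrow> 'a set set"
  where "cycle_edges xs = {{xs ! i, xs ! (Suc i mod length xs)} | i. i < length xs}"


section \<open>The incidence algebra\<close>

typedef (overloaded) ('x, 'r) incidence =
  "{f :: 'x::order \<Rightarrow> 'x \<Rightarrow> 'r::zero. \<forall>x y. \<not> x \<le> y \<longrightarrow> f x y = 0}"
  morphisms inc_apply Abs_incidence
  by (rule exI[of _ "\<lambda>_ _. 0"]) simp

setup_lifting type_definition_incidence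

instantiation incidence :: ("{finite, order}", comm_ring_1) ring_1
begin

lift_definition zero_incidence :: "('a, 'b) incidence" is "\<lambda>_ _. 0"
  by simp

lift_definition one_incidence :: "('a, 'b) incidence" is "\<lambda>x y. if x = y then 1 else 0"
  by auto

lift_definition plus_incidence :: "('a, 'b) incidence \<Rightarrow> ('a, 'b) incidence \<Rightarrow> ('a, 'b) incidence"
  is "\<lambda>f g x y. f x y + g x y"
  by simp

lift_definition uminus_incidence :: "('a, 'b) incidence \<Rightarrow> ('a, 'b) incidence"
  is "\<lambda>f x y. - f x y"
  by simp

lift_definition minus_incidence :: "('a, 'b) incidence \<Rightarrow> ('a, 'b) incidence \<Rightarrow> ('a, 'b) incidence"
  is "\<lambda>f g x y. f x y - g x y"
  by simp

lift_definition times_incidence :: "('a, 'b) incidence \<Rightarrow> ('a, 'b) incidence \<Rightarrow> ('a, 'b) incidence"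
  is "\<lambda>f g x y. \<Sum>z\<in>{x..y}. f x z * g z y"
  by simp

instance
proof
  fix a b c :: "('a, 'b) incidence"
  show "a + b + c = a + (b + c)" by transfer (simp add: add.assoc)
  show "a + b = b + a" by transfer (simp add: add.commute)
  show "0 + a = a" by transfer simp
  show "- a + a = 0" by transfer simp
  show "a - b = a + - b" by transfer simp
  show "(a + b) * c = a * c + b * c"
    by transfer (simp add: distrib_right sum.distrib)
  show "a * (b + c) = a * b + a * c"
    by transfer (simp add: distrib_left sum.distrib)
  show "(0 :: ('a, 'b) incidence) \<noteq> 1"
    by transfer (auto simp: fun_eq_iff)
  show "1 * a = a"
  proof (transfer, intro ext)
    fix f :: "'a \<Rightarrow> 'a \<Rightarrow> 'b" and x y
    assume "\<forall>x y. \<not> x \<le> y \<longrightarrow> f x y = 0"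
    moreover have "(\<Sum>z\<in>{x..y}. (if x = z then 1 else 0) * f z y)
        = (\<Sum>z\<in>{x..y}. if x = z then f z y else 0)"
      by (rule sum.cong) auto
    ultimately show "(\<Sum>z\<in>{x..y}. (if x = z then 1 else 0) * f z y) = f x y"
      by (auto simp: sum.delta')
  qed
  show "a * 1 = a"
  proof (transfer, intro ext)
    fix f :: "'a \<Rightarrow> 'a \<Rightarrow> 'b" and x y
    assume "\<forall>x y. \<not> x \<le> y \<longrightarrow> f x y = 0"
    moreover have "(\<Sum>z\<in>{x..y}. f x z * (if z = y then 1 else 0))
        = (\<Sum>z\<in>{x..y}. if z = y then f x z else 0)"
      by (rule sum.cong) auto
    ultimately show "(\<Sum>z\<in>{x..y}. f x z * (if z = y then 1 else 0)) = f x y"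
      by (auto simp: sum.delta)
  qed
  show "a * b * c = a * (b * c)"
  proof (transfer, intro ext)
    fix f g h :: "'a \<Rightarrow> 'a \<Rightarrow> 'b" and x y
    have "(\<Sum>z\<in>{x..y}. (\<Sum>w\<in>{x..z}. f x w * g w z) * h z y)
        = (\<Sum>(z, w)\<in>(SIGMA z:{x..y}. {x..z}). f x w * g w z * h z y)"
      by (simp add: sum_distrib_right sum.Sigma)
    also have "\<dots> = (\<Sum>(w, z)\<in>(SIGMA w:{x..y}. {w..y}). f x w * g w z * h z y)"
      by (rule sum.reindex_bij_witness[of _ prod.swap prod.swap]) (auto intro: order_trans)
    also have "\<dots> = (\<Sum>w\<in>{x..y}. f x w * (\<Sum>z\<in>{w..y}. g w z * h z y))"
      by (simp add: sum_distrib_left sum.Sigma mult.assoc)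
    finally show "(\<Sum>z\<in>{x..y}. (\<Sum>w\<in>{x..z}. f x w * g w z) * h z y)
        = (\<Sum>w\<in>{x..y}. f x w * (\<Sum>z\<in>{w..y}. g w z * h z y))" .
  qed
qed

end

lift_definition inc_scale ::
  "'r::comm_ring_1 \<Rightarrow> ('x::{finite, order}, 'r) incidence \<Rightarrow> ('x, 'r) incidence"
  is "\<lambda>r f x y. r * f x y"
  by simp

interpretation incidence: module inc_scale
  by standard (transfer; simp add: distrib_left distrib_right mult.assoc)+

abbreviation inc_linear ::
  "(('x::{finite, order}, 'r::comm_ring_1) incidence \<Rightarrow> ('x, 'r) incidence) \<Rightarrow> bool"
  where "inc_linear \<equiv> module_hom inc_scale inc_scale"

definition ring_center :: "'a::ring_1 set"
  where "ring_center = {z. \<forall>a. z * a = a * z}"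

definition inc_derivation ::
  "(('x::{finite, order}, 'r::comm_ring_1) incidence \<Rightarrow> ('x, 'r) incidence) \<Rightarrow> bool"
  where "inc_derivation D \<longleftrightarrow> inc_linear D \<and> (\<forall>f g. D (f * g) = D f * g + f * D g)"

end

theory Submission
  imports Defs
begin

text \<open>Both statements are equivalent to the absence of cut vertices in the comparability graph.

  If \<open>F\<^sub>1, \<dots>, F\<^sub>4\<close> solve the identity, the bilinear map
  \<open>B f g = F\<^sub>1 f * g + f * F\<^sub>2 g + F\<^sub>3 g * f + g * F\<^sub>4 f\<close> vanishes on pairs of matrix units with zero
  products, and the pairs \<open>e\<^sub>x\<^sub>y - e\<^sub>x, e\<^sub>y\<^sub>z + e\<^sub>x\<^sub>z\<close> with \<open>x < y \<le> z\<close> give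
  \<open>B(e\<^sub>x\<^sub>y, e\<^sub>y\<^sub>z) = B(e\<^sub>x, e\<^sub>x\<^sub>z)\<close>. Comparing entries determines every coefficient of the \<open>F\<^sub>i\<close> up to the
  asserted form, except that the diagonal of \<open>F\<^sub>i(e\<^sub>z)\<close> is only seen to be constant along edges avoiding
  \<open>z\<close>, and that of \<open>F\<^sub>i(e\<^sub>x\<^sub>y)\<close> along edges other than \<open>{x, y}\<close>. Without cut vertices these edges
  connect \<open>X - {z}\<close> and \<open>X\<close>, so the diagonals are the scalars \<open>\<Omega>\<^sub>i\<close>. The remaining identities for
  \<open>F\<^sub>3, F\<^sub>4\<close> follow from those for \<open>F\<^sub>1, F\<^sub>2\<close> because the hypothesis is symmetric under exchanging the
  two pairs.

  Conversely, a cut vertex \<open>p\<close> yields a linear map \<open>\<theta>\<close> with \<open>\<theta>(f) g - g \<theta>(f) = f \<theta>(g) - \<theta>(g) f\<close>, so that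
  \<open>(\<theta>, -\<theta>, \<theta>, -\<theta>)\<close> is a solution. Were it of the asserted form, \<open>2 \<theta>(e\<^sub>p)\<close> would agree
  off the vertex \<open>p\<close> with a scalar diagonal, whereas \<open>\<theta>(e\<^sub>p)\<close> is \<open>1\<close> on one side of \<open>p\<close> and
  \<open>0\<close> on the other.\<close>

section \<open>Cut vertices and cycles\<close>

definition adj_avoiding :: "('a \<Rightarrow> 'a \<Rightarrow> bool) \<Rightarrow> 'a \<Rightarrow> 'a \<Rightarrow> 'a \<Rightarrow> bool"
  where "adj_avoiding E v x y \<longleftrightarrow> E x y \<and> x \<noteq> v \<and> y \<noteq> v"

definition no_cut_vertex :: "('a \<Rightarrow> 'a \<Rightarrow> bool) \<Rightarrow> bool"
  where "no_cut_vertex E \<longleftrightarrow> (\<forall>v x y. x \<noteq> v \<longrightarrow> y \<noteq> v \<longrightarrow> (adj_avoiding E v)\<^sup>*\<^sup>* x y)"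

text \<open>Deleting one vertex from a cycle leaves a path through all the others; symmetry lets it
  be walked both ways.\<close>

lemma graph_cycle_connected_avoiding:
  assumes cyc: "graph_cycle E xs" and "v \<in> set xs" "x \<in> set xs" "y \<in> set xs" "x \<noteq> v" "y \<noteq> v"
    and sym: "symp E"
  shows "(adj_avoiding E v)\<^sup>*\<^sup>* x y"
proof -
  let ?n = "length xs" and ?R = "adj_avoiding E v"
  have n: "3 \<le> ?n" and dist: "distinct xs"
    and adj: "\<And>i. i < ?n \<Longrightarrow> E (xs ! i) (xs ! (Suc i mod ?n))"
    using cyc by (auto simp: graph_cycle_def)
  obtain i where i: "i < ?n" "xs ! i = v"
    using \<open>v \<in> set xs\<close> by (auto simp: in_set_conv_nth)
  \<comment> \<open>The walk starts at the successor of \<open>v\<close>; \<open>k = ?n - 1\<close>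
    would return to \<open>v\<close>, hence the bound \<open>Suc k < ?n\<close> below.\<close>
  let ?w = "\<lambda>k. xs ! ((i + Suc k) mod ?n)"
  have avoid: "?w k \<noteq> v" if "Suc k < ?n" for k
  proof
    assume "?w k = v"
    then have "(i + Suc k) mod ?n = i"
      using i n dist by (metis mod_less_divisor nth_eq_iff_index_eq less_le_trans zero_less_numeral)
    then have "(i + Suc k) mod ?n = (i + 0) mod ?n"
      using i by simp
    then have "?n dvd Suc k"
      by (metis add_diff_cancel_left' diff_zero le_add1 mod_eq_dvd_iff_nat add_0_right)
    then show False
      using that by (auto dest: dvd_imp_le)
  qed
  have reach: "?R\<^sup>*\<^sup>* (?w 0) (?w k)" if "Suc k < ?n" for k
    using that
  proof (induction k)
    case (Suc k)
    have "(i + Suc k) mod ?n < ?n"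
      using n by (intro mod_less_divisor) auto
    from adj[OF this] have "E (?w k) (?w (Suc k))"
      by (simp add: mod_Suc_eq)
    then have "?R (?w k) (?w (Suc k))"
      using avoid[of k] avoid[of "Suc k"] Suc.prems by (auto simp: adj_avoiding_def)
    then show ?case
      using Suc by (meson Suc_lessD rtranclp.rtrancl_into_rtrancl)
  qed simp
  have reach': "?R\<^sup>*\<^sup>* (?w 0) z" if z: "z \<in> set xs" "z \<noteq> v" for z
  proof -
    obtain j where j: "j < ?n" "xs ! j = z"
      using z by (auto simp: in_set_conv_nth)
    then have ne: "j \<noteq> i"
      using i z by auto
    obtain k where "Suc k < ?n" "(i + Suc k) mod ?n = j"
    proof (cases "i < j")
      case True
      then show ?thesis
        using j that[of "j - i - 1"] by simp
    next
      case False
      then have "(i + Suc (j + ?n - i - 1)) = j + ?n"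
        using ne i by simp
      then show ?thesis
        using that[of "j + ?n - i - 1"] False ne i j by simp
    qed
    then show ?thesis
      using reach[of k] j by auto
  qed
  have "symp ?R"
    using sym by (auto simp: symp_def adj_avoiding_def)
  then have "symp ?R\<^sup>*\<^sup>*"
    by (rule symp_rtranclp)
  then show ?thesis
    using reach'[of x] reach'[of y] assms by (meson rtranclp_trans sympD)
qed

section \<open>Common cycles exclude cut vertices\<close>

lemma rtranclp_leaves_set:
  assumes "R\<^sup>*\<^sup>* x y" "x \<in> A" "y \<notin> A"
  shows "\<exists>a b. R a b \<and> a \<in> A \<and> b \<notin> A"
  using assms by (induction rule: rtranclp_induct) blast+

text \<open>A cut vertex \<open>v\<close> has an edge into the component of \<open>x\<close> and an
  edge to a vertex outside it. A cycle through both, with \<open>v\<close> removed, would still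
  connect the two sides.\<close>

lemma no_cut_vertexI:
  assumes sym: "symp E" and conn: "graph_connected E"
    and cyc: "\<forall>e \<in> graph_edges E. \<forall>e' \<in> graph_edges E. e \<noteq> e' \<longrightarrow>
      (\<exists>xs. graph_cycle E xs \<and> e \<in> cycle_edges xs \<and> e' \<in> cycle_edges xs)"
  shows "no_cut_vertex E"
  unfolding no_cut_vertex_def
proof (intro allI impI, rule ccontr)
  fix v x y assume ne: "x \<noteq> v" "y \<noteq> v" and not_reach: "\<not> (adj_avoiding E v)\<^sup>*\<^sup>* x y"
  let ?R = "adj_avoiding E v"
  let ?Y = "{w. ?R\<^sup>*\<^sup>* x w}"
  have v: "v \<notin> ?Y"
  proof
    assume "v \<in> ?Y"
    then have "?R\<^sup>*\<^sup>* x v" by simp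
    then show False
      using ne by (cases rule: rtranclp.cases) (auto simp: adj_avoiding_def)
  qed
  obtain y1 z1 where y1: "E y1 z1" "y1 \<in> ?Y" "z1 \<notin> ?Y"
    using rtranclp_leaves_set[of E x v ?Y] conn v by (auto simp: graph_connected_def)
  have "z1 = v"
  proof (rule ccontr)
    assume "z1 \<noteq> v"
    then have "?R y1 z1"
      using y1 v by (auto simp: adj_avoiding_def)
    then show False
      using y1 by (auto intro: rtranclp.rtrancl_into_rtrancl)
  qed
  obtain w1 z2 where w1: "E w1 z2" "w1 \<notin> ?Y" "w1 \<noteq> v" "z2 \<in> ?Y \<or> z2 = v"
    using rtranclp_leaves_set[of E y v "- insert v ?Y"] conn not_reach ne
    by (auto simp: graph_connected_def)
  have "z2 = v"
  proof (rule ccontr)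
    assume "z2 \<noteq> v"
    then have "?R z2 w1"
      using w1 sym by (auto simp: adj_avoiding_def sympD)
    then show False
      using w1 \<open>z2 \<noteq> v\<close> by (auto intro: rtranclp.rtrancl_into_rtrancl)
  qed
  have "{y1, v} \<in> graph_edges E" "{w1, v} \<in> graph_edges E" "{y1, v} \<noteq> {w1, v}"
    using y1 w1 \<open>z1 = v\<close> \<open>z2 = v\<close> v by (auto simp: graph_edges_def doubleton_eq_iff)
  then obtain xs where xs: "graph_cycle E xs" "{y1, v} \<in> cycle_edges xs" "{w1, v} \<in> cycle_edges xs"
    using cyc[rule_format, of "{y1, v}" "{w1, v}"] by auto
  have "Suc i mod length xs < length xs" if "i < length xs" for i
    using that by (intro mod_less_divisor) auto
  then have "\<Union>(cycle_edges xs) \<subseteq> set xs"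
    by (auto simp: cycle_edges_def)
  then have "y1 \<in> set xs" "w1 \<in> set xs" "v \<in> set xs"
    using xs(2,3) by auto
  then have "?R\<^sup>*\<^sup>* y1 w1"
    using graph_cycle_connected_avoiding[OF xs(1) _ _ _ _ _ sym] y1 w1 v by auto
  then show False
    using y1 w1 by (auto intro: rtranclp_trans)
qed

text \<open>A walk is stopped at its first vertex in \<open>A\<close> and freed of repetitions.
  Building from the far end makes this local: the new head lies in \<open>A\<close>, already occurs
  in \<open>ps\<close>, or is simply prepended.\<close>

lemma path_to_set:
  assumes "(adj_avoiding E v)\<^sup>*\<^sup>* w t" "t \<in> A" "w \<noteq> v"
  shows "\<exists>ps c. successively E (ps @ [c]) \<and> distinct (ps @ [c]) \<and> hd (ps @ [c]) = w \<and>
    v \<notin> set (ps @ [c]) \<and> set ps \<inter> A = {} \<and> c \<in> A"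
  using assms
proof (induction rule: converse_rtranclp_induct)
  case base
  then show ?case
    by (intro exI[of _ "[]"] exI[of _ t]) auto
next
  case (step w w')
  then have "w' \<noteq> v" "E w w'"
    by (auto simp: adj_avoiding_def)
  with step obtain ps c where p: "successively E (ps @ [c])" "distinct (ps @ [c])"
    "hd (ps @ [c]) = w'" "v \<notin> set (ps @ [c])" "set ps \<inter> A = {}" "c \<in> A"
    by blast
  consider "w \<in> A" | "w \<notin> A" "w \<in> set ps" | "w \<notin> A" "w \<notin> set ps"
    by blast
  then show ?case
  proof cases
    case 1
    then show ?thesis
      using step.prems by (intro exI[of _ "[]"] exI[of _ w]) auto
  next
    case 2
    then obtain l1 l2 where "ps = l1 @ w # l2"
      by (meson split_list)
    then show ?thesis
      using p 2 by (intro exI[of _ "w # l2"] exI[of _ c]) (auto simp: successively_append_iff)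
  next
    case 3
    have "successively E ((w # ps) @ [c])"
      using p \<open>E w w'\<close> by (cases ps) auto
    then show ?thesis
      using p 3 step.prems by (intro exI[of _ "w # ps"] exI[of _ c]) auto
  qed
qed

section \<open>Simple paths rerouted through a prescribed edge\<close>

definition simple_path :: "('a \<Rightarrow> 'a \<Rightarrow> bool) \<Rightarrow> 'a \<Rightarrow> 'a \<Rightarrow> 'a list \<Rightarrow> bool"
  where "simple_path E a b p \<longleftrightarrow>
    successively E p \<and> distinct p \<and> p \<noteq> [] \<and> hd p = a \<and> last p = b"

text \<open>The interior \<open>s\<close> of the detour misses the path, so exchanging
  \<open>m\<close> for \<open>s\<close> creates no repetition and keeps both ends.\<close>

lemma simple_path_splice:
  assumes "simple_path E a b (l @ x # m @ y # r)" and "successively E (x # s @ [y])"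
    and "distinct s" and "set s \<inter> set (l @ x # m @ y # r) = {}"
  shows "simple_path E a b (l @ x # s @ y # r)"
proof -
  have "successively E ((l @ [x]) @ (m @ y # r))"
    using assms(1) by (simp add: simple_path_def)
  then have l: "successively E (l @ [x])"
    unfolding successively_append_iff by blast
  have "successively E ((l @ x # m) @ (y # r))"
    using assms(1) by (simp add: simple_path_def)
  then have r: "successively E (y # r)"
    unfolding successively_append_iff by blast
  have "successively E ((x # s) @ (y # r))"
    using assms(2) r successively_append_iff[of E "x # s" "[y]"]
      successively_append_iff[of E "x # s" "y # r"] by simp
  then have "successively E (l @ x # s @ y # r)"
    using l successively_append_iff[of E l "[x]"]
      successively_append_iff[of E l "x # s @ y # r"] by simp
  moreover have "hd (l @ x # s @ y # r) = a"
    using assms(1) by (cases l) (auto simp: simple_path_def)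
  moreover have "last (l @ x # s @ y # r) = b"
    using assms(1) by (auto simp: simple_path_def)
  moreover have "distinct (l @ x # s @ y # r)"
    using assms by (auto simp: simple_path_def)
  ultimately show ?thesis
    by (simp add: simple_path_def)
qed

text \<open>As \<open>v\<close> is no cut vertex, \<open>w\<close> reaches the rest of the path
  without passing \<open>v\<close>. The detour from \<open>v\<close> over \<open>w\<close> to the
  first vertex \<open>c\<close> met on the path replaces the segment between \<open>v\<close> and
  \<open>c\<close>. If \<open>w\<close> is on the path already, then \<open>c = w\<close>.\<close>

lemma simple_path_reroute:
  assumes ncv: "no_cut_vertex E" and sym: "symp E" and irrefl: "irreflp E"
    and p: "simple_path E a b p" and "a \<noteq> b" and v: "v \<in> set p" and vw: "E v w"
  shows "\<exists>q l r. simple_path E a b q \<and> (q = l @ [v, w] @ r \<or> q = l @ [w, v] @ r)"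
proof -
  have "w \<noteq> v"
    using vw irrefl by (auto simp: irreflp_def)
  obtain t where "t \<in> set p" "t \<noteq> v"
    using p \<open>a \<noteq> b\<close> unfolding simple_path_def by (metis hd_in_set last_in_set)
  then have "(adj_avoiding E v)\<^sup>*\<^sup>* w t"
    using ncv \<open>w \<noteq> v\<close> by (auto simp: no_cut_vertex_def)
  from path_to_set[OF this \<open>t \<in> set p\<close> \<open>w \<noteq> v\<close>]
  obtain ps c where c: "successively E (ps @ [c])" "distinct (ps @ [c])"
    "hd (ps @ [c]) = w" "v \<notin> set (ps @ [c])" "set ps \<inter> set p = {}" "c \<in> set p"
    by blast
  have v_ps: "successively E (v # ps @ [c])"
    using c vw by (cases "ps @ [c]") auto
  obtain ps' where ps': "ps @ [c] = w # ps'"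
    using c(3) by (cases "ps @ [c]") auto
  obtain l r where lr: "p = l @ v # r"
    using v by (meson split_list)
  consider (after) r1 r2 where "r = r1 @ c # r2" | (before) l1 l2 where "l = l1 @ c # l2"
    using c lr by (auto dest!: split_list)
  then show ?thesis
  proof cases
    case after
    have "simple_path E a b (l @ v # ps @ c # r2)"
      by (rule simple_path_splice[of _ _ _ _ _ r1]) (use p lr after v_ps c in auto)
    moreover have "l @ v # ps @ c # r2 = l @ v # (ps @ [c]) @ r2"
      by simp
    then have "l @ v # ps @ c # r2 = l @ [v, w] @ (ps' @ r2)"
      unfolding ps' by simp
    ultimately show ?thesis
      by blast
  next
    case before
    \<comment> \<open>When \<open>c\<close> precedes \<open>v\<close>, the detour is traversed
      backwards, from \<open>c\<close> to \<open>v\<close>.\<close>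
    have "successively (\<lambda>x y. E y x) (v # ps @ [c])"
      using v_ps by (rule successively_mono) (use sym in \<open>auto dest: sympD\<close>)
    then have "successively E (rev (v # ps @ [c]))"
      by (simp only: successively_rev)
    then have "successively E (c # rev ps @ [v])"
      by simp
    then have "simple_path E a b (l1 @ c # rev ps @ v # r)"
      by (rule simple_path_splice[of _ _ _ _ _ l2, rotated]) (use p lr before c in auto)
    moreover have "l1 @ c # rev ps @ v # r = l1 @ rev (ps @ [c]) @ v # r"
      by simp
    then have "l1 @ c # rev ps @ v # r = (l1 @ rev ps') @ [w, v] @ r"
      unfolding ps' by simp
    ultimately show ?thesis
      by blast
  qed
qed

text \<open>Rerouting a simple path from \<open>a\<close> to \<open>b\<close> along a walk from
  \<open>a\<close> to \<open>v\<close> brings \<open>v\<close> onto it; one more rerouting brings in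
  the edge \<open>e'\<close>. The edge \<open>e\<close> then closes the path to a cycle.\<close>

lemma no_cut_vertex_common_cycle:
  assumes ncv: "no_cut_vertex E" and sym: "symp E" and irrefl: "irreflp E"
    and conn: "graph_connected E"
    and e: "e \<in> graph_edges E" and e': "e' \<in> graph_edges E" and ne: "e \<noteq> e'"
  shows "\<exists>xs. graph_cycle E xs \<and> e \<in> cycle_edges xs \<and> e' \<in> cycle_edges xs"
proof -
  obtain a b where ab: "e = {a, b}" "E a b"
    using e by (auto simp: graph_edges_def)
  obtain v w where vw: "e' = {v, w}" "E v w"
    using e' by (auto simp: graph_edges_def)
  have "a \<noteq> b"
    using ab irrefl by (auto simp: irreflp_def)
  note reroute = simple_path_reroute[OF ncv sym irrefl _ \<open>a \<noteq> b\<close>]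
  have "E\<^sup>*\<^sup>* a v"
    using conn by (simp add: graph_connected_def)
  then have "\<exists>p. simple_path E a b p \<and> v \<in> set p"
  proof (induction rule: rtranclp_induct)
    case base
    then show ?case
      using ab \<open>a \<noteq> b\<close> by (intro exI[of _ "[a, b]"]) (auto simp: simple_path_def)
  next
    case (step v w)
    then obtain p where "simple_path E a b p" "v \<in> set p"
      by blast
    from reroute[OF this \<open>E v w\<close>] show ?case
      by fastforce
  qed
  then obtain p where p: "simple_path E a b p" "v \<in> set p"
    by blast
  obtain q l r where q: "simple_path E a b q" "q = l @ [v, w] @ r \<or> q = l @ [w, v] @ r"
    using reroute[OF p vw(2)] by blast
  note q' = q(1)[unfolded simple_path_def]
  \<comment> \<open>A path with only two vertices would have \<open>e\<close> as its single edge,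
    forcing \<open>e = e'\<close>.\<close>
  have len: "3 \<le> length q"
  proof (rule ccontr)
    assume "\<not> 3 \<le> length q"
    then have "l = [] \<and> r = []"
      using q(2) by (cases l; cases r) auto
    then show False
      using q(2) q' ne ab vw by auto
  qed
  have first: "q ! 0 = a" and last: "q ! (length q - 1) = b"
    using q' hd_conv_nth[of q] last_conv_nth[of q] by auto
  have wrap: "Suc i mod length q = (if i = length q - 1 then 0 else Suc i)" if "i < length q" for i
    using that by (auto simp: mod_if)
  have "graph_cycle E q"
    unfolding graph_cycle_def
  proof (intro conjI allI impI)
    fix i assume i: "i < length q"
    show "E (q ! i) (q ! (Suc i mod length q))"
    proof (cases "i = length q - 1")
      case True
      then show ?thesis
        using ab sym first last wrap[OF i] by (auto dest: sympD)
    next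
      case False
      then show ?thesis
        using q' i wrap[OF i] by (auto simp: successively_conv_nth)
    qed
  qed (use q' len in auto)
  moreover have "e \<in> cycle_edges q"
    unfolding cycle_edges_def using len first last ab wrap[of "length q - 1"]
    by (intro CollectI exI[of _ "length q - 1"]) auto
  moreover have "e' \<in> cycle_edges q"
    unfolding cycle_edges_def using len vw q(2) wrap[of "length l"]
    by (intro CollectI exI[of _ "length l"]) (auto simp: nth_append)
  ultimately show ?thesis
    by blast
qed

section \<open>Matrix units of the incidence algebra\<close>

lift_definition munit :: "'x::order \<Rightarrow> 'x \<Rightarrow> ('x, 'r::comm_ring_1) incidence"
  is "\<lambda>x y a b. if a = x \<and> b = y \<and> x \<le> y then 1 else 0"
  by auto

text \<open>The entrywise (Hadamard) product with \<open>s\<close>; for additive \<open>s\<close> it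
  is a derivation that rescales matrix units.\<close>

lift_definition schur :: "('x::order \<Rightarrow> 'x \<Rightarrow> 'r) \<Rightarrow> ('x, 'r::comm_ring_1) incidence \<Rightarrow> ('x, 'r) incidence"
  is "\<lambda>s f x y. s x y * f x y"
  by auto

lemma incidence_eqI:
  assumes "\<And>a b. inc_apply f a b = inc_apply g a b"
  shows "f = g"
  using assms by (auto simp: inc_apply_inject[symmetric] fun_eq_iff)

lemma inc_apply_eq_0:
  "\<not> a \<le> b \<Longrightarrow> inc_apply f a b = 0"
  using inc_apply[of f] by auto

lemmas inc_apply_simps = zero_incidence.rep_eq one_incidence.rep_eq plus_incidence.rep_eq
  uminus_incidence.rep_eq minus_incidence.rep_eq inc_scale.rep_eq schur.rep_eq munit.rep_eq

lemma inc_apply_sum: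
  "inc_apply (\<Sum>i\<in>I. f i) a b = (\<Sum>i\<in>I. inc_apply (f i) a b)"
  by (induction I rule: infinite_finite_induct) (auto simp: inc_apply_simps)

lemma inc_apply_mult_munit:
  assumes "x \<le> y"
  shows "inc_apply (f * munit x y) a b = (if b = y then inc_apply f a x else 0)"
proof -
  have "inc_apply (f * munit x y) a b
      = (\<Sum>z\<in>{a..b}. if z = x then (if b = y then inc_apply f a x else 0) else 0)"
    unfolding times_incidence.rep_eq by (rule sum.cong) (auto simp: munit.rep_eq assms)
  then show ?thesis
    using assms by (auto simp: inc_apply_eq_0)
qed

lemma inc_apply_munit_mult:
  assumes "x \<le> y"
  shows "inc_apply (munit x y * f) a b = (if a = x then inc_apply f y b else 0)"
proof -
  have "inc_apply (munit x y * f) a b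
      = (\<Sum>z\<in>{a..b}. if z = y then (if a = x then inc_apply f y b else 0) else 0)"
    unfolding times_incidence.rep_eq by (rule sum.cong) (auto simp: munit.rep_eq assms)
  then show ?thesis
    using assms by (auto simp: inc_apply_eq_0)
qed

lemma munit_mult_munit:
  "x \<le> y \<Longrightarrow> u \<le> v \<Longrightarrow> munit x y * munit u v = (if y = u then munit x v else 0)"
  by (rule incidence_eqI) (auto simp: inc_apply_mult_munit inc_apply_simps)

lemma incidence_expand:
  fixes f :: "('x::{finite, order}, 'r::comm_ring_1) incidence"
  shows "f = (\<Sum>x\<in>UNIV. \<Sum>y\<in>{x..}. inc_scale (inc_apply f x y) (munit x y))"
proof (rule incidence_eqI)
  fix a b :: 'x
  have "(\<Sum>y\<in>{x..}. inc_apply f x y * inc_apply (munit x y) a b)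
      = (if x = a then inc_apply f a b else 0)" for x
  proof -
    have "(\<Sum>y\<in>{x..}. inc_apply f x y * inc_apply (munit x y) a b)
        = (\<Sum>y\<in>{x..}. if y = b then (if x = a then inc_apply f a b else 0) else 0)"
      by (rule sum.cong) (auto simp: munit.rep_eq)
    then show ?thesis
      by (auto simp: inc_apply_eq_0)
  qed
  then show "inc_apply f a b
      = inc_apply (\<Sum>x\<in>UNIV. \<Sum>y\<in>{x..}. inc_scale (inc_apply f x y) (munit x y)) a b"
    by (simp add: inc_apply_sum inc_apply_simps)
qed

lemma inc_linear_expand:
  assumes "inc_linear F"
  shows "F f = (\<Sum>x\<in>UNIV. \<Sum>y\<in>{x..}. inc_scale (inc_apply f x y) (F (munit x y)))"
  by (subst incidence_expand[of f])
    (simp add: module_hom.sum[OF assms] module_hom.scale[OF assms])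

lemma inc_linear_eqI:
  assumes "inc_linear F" "inc_linear G" "\<And>x y. x \<le> y \<Longrightarrow> F (munit x y) = G (munit x y)"
  shows "F f = G f"
  unfolding inc_linear_expand[OF assms(1), of f] inc_linear_expand[OF assms(2), of f]
  by (intro sum.cong refl arg_cong2[of _ _ _ _ inc_scale]) (use assms(3) in auto)

lemma inc_linearI:
  assumes "\<And>f g. F (f + g) = F f + F g" "\<And>r f. F (inc_scale r f) = inc_scale r (F f)"
  shows "inc_linear F"
  using assms by unfold_locales auto

lemma inc_scale_mult_left: "inc_scale r f * g = inc_scale r (f * g)"
  by (rule incidence_eqI) (simp add: inc_apply_simps times_incidence.rep_eq sum_distrib_left mult.assoc)

lemma inc_scale_mult_right: "f * inc_scale r g = inc_scale r (f * g)"
  by (rule incidence_eqI)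
    (simp add: inc_apply_simps times_incidence.rep_eq sum_distrib_left mult.left_commute)

lemma inc_linear_add: "inc_linear F \<Longrightarrow> inc_linear G \<Longrightarrow> inc_linear (\<lambda>f. F f + G f)"
  by (rule inc_linearI)
    (simp_all add: module_hom.add module_hom.scale algebra_simps)

lemma inc_linear_diff: "inc_linear F \<Longrightarrow> inc_linear G \<Longrightarrow> inc_linear (\<lambda>f. F f - G f)"
  by (rule inc_linearI)
    (simp_all add: module_hom.add module_hom.scale algebra_simps)

lemma inc_linear_mult_left: "inc_linear (\<lambda>f. c * f)"
  by (rule inc_linearI) (simp_all add: algebra_simps inc_scale_mult_right)

lemma inc_linear_mult_right: "inc_linear (\<lambda>f. f * c)"
  by (rule inc_linearI) (simp_all add: algebra_simps inc_scale_mult_left)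

section \<open>Derivations and central elements\<close>

lemma inc_linear_schur: "inc_linear (schur s)"
  by (rule inc_linearI; rule incidence_eqI) (simp_all add: inc_apply_simps algebra_simps)

text \<open>Additivity splits the factor \<open>s a b\<close> inside each term of the convolution,
  which is the Leibniz rule term by term.\<close>

lemma schur_mult:
  assumes "\<And>a c b. a \<le> c \<Longrightarrow> c \<le> b \<Longrightarrow> s a b = s a c + s c b"
  shows "schur s (f * g) = schur s f * g + f * schur s g"
proof (rule incidence_eqI)
  fix a b
  have "s a b * (\<Sum>c\<in>{a..b}. inc_apply f a c * inc_apply g c b)
      = (\<Sum>c\<in>{a..b}. s a c * inc_apply f a c * inc_apply g c b
          + inc_apply f a c * (s c b * inc_apply g c b))"
    unfolding sum_distrib_left
  proof (rule sum.cong)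
    fix c assume "c \<in> {a..b}"
    then have "s a b = s a c + s c b"
      using assms by auto
    then show "s a b * (inc_apply f a c * inc_apply g c b)
        = s a c * inc_apply f a c * inc_apply g c b + inc_apply f a c * (s c b * inc_apply g c b)"
      by (simp only: algebra_simps)
  qed simp
  then show "inc_apply (schur s (f * g)) a b = inc_apply (schur s f * g + f * schur s g) a b"
    by (simp only: inc_apply_simps times_incidence.rep_eq sum.distrib)
qed

lemma inc_derivation_commutator_schur:
  assumes "\<And>a c b. a \<le> c \<Longrightarrow> c \<le> b \<Longrightarrow> s a b = s a c + s c b"
  shows "inc_derivation (\<lambda>f. c * f - f * c + schur s f)"
  unfolding inc_derivation_def
  by (auto intro!: inc_linear_add inc_linear_diff inc_linear_mult_left inc_linear_mult_right
      inc_linear_schur simp: schur_mult[OF assms] algebra_simps)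

lemma inc_scale_one_in_ring_center: "inc_scale r 1 \<in> ring_center"
  by (simp add: ring_center_def inc_scale_mult_left inc_scale_mult_right)

text \<open>Commuting with \<open>munit x y\<close> equates the diagonal at the ends of a comparable
  pair; connectedness carries this through the poset.\<close>

lemma ring_center_diagonal_constant:
  fixes z :: "('x::{finite, order}, 'r::comm_ring_1) incidence"
  assumes "z \<in> ring_center" and "graph_connected (comparability :: 'x \<Rightarrow> 'x \<Rightarrow> bool)"
  shows "inc_apply z a a = inc_apply z b b"
proof -
  have le: "inc_apply z x x = inc_apply z y y" if "x \<le> y" for x y
  proof -
    have "inc_apply (z * munit x y) x y = inc_apply (munit x y * z) x y"
      using assms(1) by (simp add: ring_center_def)
    then show ?thesis
      using that by (simp add: inc_apply_mult_munit inc_apply_munit_mult)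
  qed
  have "comparability\<^sup>*\<^sup>* a b"
    using assms(2) by (simp add: graph_connected_def)
  then show ?thesis
    by (induction rule: rtranclp_induct) (auto simp: comparability_def dest!: less_imp_le le)
qed

section \<open>The improper solution at a cut vertex\<close>

text \<open>If \<open>W\<close> is a union of components of \<open>X - {p}\<close> and \<open>f\<close> is restricted to the pairs outside \<open>W\<close>,
  the diagonal correction \<open>f(p,p)\<close> on \<open>W\<close> makes the result commute with \<open>f\<close>.\<close>

lift_definition cut_map ::
  "'x::order \<Rightarrow> 'x set \<Rightarrow> ('x, 'r::comm_ring_1) incidence \<Rightarrow> ('x, 'r) incidence"
  is "\<lambda>p W f x y. if x \<notin> W \<and> y \<notin> W then f x y else if x = y then f p p else 0"
  by auto

lemma inc_linear_cut_map: "inc_linear (cut_map p W)"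
  by (rule inc_linearI; rule incidence_eqI) (simp_all add: inc_apply_simps cut_map.rep_eq)

context
  fixes p :: "'x::{finite, order}" and W :: "'x set"
  assumes p: "p \<notin> W" and W: "\<And>x y. x \<in> W \<Longrightarrow> y \<notin> W \<Longrightarrow> comparability x y \<Longrightarrow> y = p"
begin

text \<open>A point of \<open>W\<close> between the ends would be comparable to both, forcing both
  to be \<open>p\<close> and, by antisymmetry, the point as well.\<close>

lemma interval_outside:
  assumes "x \<le> z" "z \<le> y" "x \<notin> W" "y \<notin> W"
  shows "z \<notin> W"
proof
  assume z: "z \<in> W"
  then have "comparability z x" "comparability z y"
    using assms by (auto simp: comparability_def le_less)
  then have "x = p" "y = p"
    using W[OF z] assms by blast+
  then show False
    using assms z p by auto
qed

text \<open>If \<open>x\<close> or \<open>y\<close> lies in \<open>W\<close>, only the summand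
  carrying the diagonal value \<open>inc_apply f p p\<close> survives. Otherwise
  \<open>interval_outside\<close> keeps all intermediate indices outside \<open>W\<close>, where
  \<open>cut_map\<close> changes nothing.\<close>

lemma cut_map_mult:
  "inc_apply (cut_map p W f * g) x y
    = (if x \<in> W \<or> y \<in> W then inc_apply f p p * inc_apply g x y else inc_apply (f * g) x y)"
proof (cases "x \<in> W")
  case True
  then have "inc_apply (cut_map p W f * g) x y
      = (\<Sum>z\<in>{x..y}. if z = x then inc_apply f p p * inc_apply g x y else 0)"
    unfolding times_incidence.rep_eq by (intro sum.cong) (auto simp: cut_map.rep_eq)
  then show ?thesis
    using True by (auto simp: inc_apply_eq_0)
next
  case x: False
  show ?thesis
  proof (cases "y \<in> W")
    case False
    then have "inc_apply (cut_map p W f) x z = inc_apply f x z" if "z \<in> {x..y}" for z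
      using x that interval_outside[of x z y] by (auto simp: cut_map.rep_eq)
    then show ?thesis
      using x False unfolding times_incidence.rep_eq by (auto intro!: sum.cong)
  next
    case y: True
    show ?thesis
    proof (cases "x \<le> y")
      case True
      then have "comparability y x"
        using x y by (auto simp: comparability_def le_less)
      then have "x = p"
        using W x y by blast
      have "inc_apply (cut_map p W f * g) x y
        = (\<Sum>z\<in>{x..y}. if z = p then inc_apply f p p * inc_apply g p y else 0)"
        unfolding times_incidence.rep_eq
      proof (rule sum.cong)
        fix z assume z: "z \<in> {x..y}"
        \<comment> \<open>Indices other than \<open>p\<close> in this interval lie in
          \<open>W\<close>, where row \<open>p\<close> of \<open>cut_map p W f\<close>
          vanishes.\<close>
        have "z = p" if "z \<notin> W"
        proof -
          have "comparability y z"
            using z y that by (auto simp: comparability_def le_less)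
          then show ?thesis
            using W y that by blast
        qed
        then show "inc_apply (cut_map p W f) x z * inc_apply g z y
            = (if z = p then inc_apply f p p * inc_apply g p y else 0)"
          using p \<open>x = p\<close> by (cases "z \<in> W") (auto simp: cut_map.rep_eq)
      qed simp
      then show ?thesis
        using True y \<open>x = p\<close> by simp
    next
      case False
      then show ?thesis
        using y by (simp add: inc_apply_eq_0)
    qed
  qed
qed

lemma mult_cut_map:
  "inc_apply (g * cut_map p W f) x y
    = (if x \<in> W \<or> y \<in> W then inc_apply f p p * inc_apply g x y else inc_apply (g * f) x y)"
proof (cases "y \<in> W")
  case True
  then have "inc_apply (g * cut_map p W f) x y
      = (\<Sum>z\<in>{x..y}. if z = y then inc_apply f p p * inc_apply g x y else 0)"
    unfolding times_incidence.rep_eq by (intro sum.cong) (auto simp: cut_map.rep_eq)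
  then show ?thesis
    using True by (auto simp: inc_apply_eq_0)
next
  case y: False
  show ?thesis
  proof (cases "x \<in> W")
    case False
    then have "inc_apply (cut_map p W f) z y = inc_apply f z y" if "z \<in> {x..y}" for z
      using y that interval_outside[of x z y] by (auto simp: cut_map.rep_eq)
    then show ?thesis
      using y False unfolding times_incidence.rep_eq by (auto intro!: sum.cong)
  next
    case x: True
    show ?thesis
    proof (cases "x \<le> y")
      case True
      then have "comparability x y"
        using x y by (auto simp: comparability_def le_less)
      then have "y = p"
        using W x y by blast
      have "inc_apply (g * cut_map p W f) x y
        = (\<Sum>z\<in>{x..y}. if z = p then inc_apply f p p * inc_apply g x p else 0)"
        unfolding times_incidence.rep_eq
      proof (rule sum.cong)
        fix z assume z: "z \<in> {x..y}"
        have "z = p" if "z \<notin> W"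
        proof -
          have "comparability x z"
            using z x that by (auto simp: comparability_def le_less)
          then show ?thesis
            using W x that by blast
        qed
        then show "inc_apply g x z * inc_apply (cut_map p W f) z y
            = (if z = p then inc_apply f p p * inc_apply g x p else 0)"
          using p \<open>y = p\<close> by (cases "z \<in> W") (auto simp: cut_map.rep_eq)
      qed simp
      then show ?thesis
        using True x \<open>y = p\<close> by simp
    next
      case False
      then show ?thesis
        using x by (simp add: inc_apply_eq_0)
    qed
  qed
qed

text \<open>By the two product formulas the terms cancel in pairs: as products of \<open>f\<close>
  and \<open>g\<close> outside \<open>W\<close>, as scalar multiples of \<open>f\<close> or
  \<open>g\<close> elsewhere.\<close>

lemma cut_map_commuting:
  "cut_map p W f * g + f * (- cut_map p W g) + cut_map p W g * f + g * (- cut_map p W f) = 0"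
  by (rule incidence_eqI)
    (simp add: inc_apply_simps cut_map_mult mult_cut_map)

end

lemma cut_map_improper:
  fixes C\<^sub>1 C\<^sub>2 d \<omega>\<^sub>1 \<omega>\<^sub>2 :: "('x::{finite, order}, 'r::comm_ring_1) incidence"
  assumes two: "(2 :: 'r) dvd 1"
    and conn: "graph_connected (comparability :: 'x \<Rightarrow> 'x \<Rightarrow> bool)"
    and W: "p \<notin> W" "w \<in> W" "y \<notin> W" "y \<noteq> p"
    and eq1: "cut_map p W (munit p p) = C\<^sub>1 * munit p p + d + \<omega>\<^sub>1"
    and eq2: "- cut_map p W (munit p p) = munit p p * C\<^sub>2 + d + \<omega>\<^sub>2"
    and center: "\<omega>\<^sub>1 \<in> ring_center" "\<omega>\<^sub>2 \<in> ring_center"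
  shows False
proof -
  let ?t = "cut_map p W (munit p p) :: ('x, 'r) incidence"
  have diag: "2 * inc_apply ?t z z = inc_apply \<omega>\<^sub>1 z z - inc_apply \<omega>\<^sub>2 z z" if "z \<noteq> p" for z
  proof -
    \<comment> \<open>Subtracting removes the derivation value \<open>d\<close>; the products with
      \<open>munit p p\<close> have no diagonal entry away from \<open>p\<close>.\<close>
    have "?t - (- ?t) = (C\<^sub>1 * munit p p + d + \<omega>\<^sub>1) - (munit p p * C\<^sub>2 + d + \<omega>\<^sub>2)"
      by (rule arg_cong2[OF eq1 eq2])
    from arg_cong[OF this, of "\<lambda>f. inc_apply f z z"] show ?thesis
      using that by (simp add: inc_apply_simps inc_apply_mult_munit inc_apply_munit_mult)
  qed
  have "w \<noteq> p"
    using W by auto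
  have "inc_apply ?t w w = 1" "inc_apply ?t y y = 0"
    using W by (auto simp: cut_map.rep_eq munit.rep_eq)
  then have "(2 :: 'r) = 0"
    using diag[OF \<open>w \<noteq> p\<close>] diag[OF \<open>y \<noteq> p\<close>] center[THEN ring_center_diagonal_constant[OF _ conn], of w y]
    by simp
  then show False
    using two by simp
qed

section \<open>Coefficients of a solution\<close>

abbreviation coeff :: "(('x::{finite, order}, 'r::comm_ring_1) incidence \<Rightarrow> ('x, 'r) incidence)
    \<Rightarrow> 'x \<Rightarrow> 'x \<Rightarrow> 'x \<Rightarrow> 'x \<Rightarrow> 'r"
  where "coeff F x y a b \<equiv> inc_apply (F (munit x y)) a b"

locale zero_product_identity =
  fixes F\<^sub>1 F\<^sub>2 F\<^sub>3 F\<^sub>4 :: "('x::{finite, order}, 'r::comm_ring_1) incidence \<Rightarrow> ('x, 'r) incidence"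
  assumes linear: "inc_linear F\<^sub>1" "inc_linear F\<^sub>2" "inc_linear F\<^sub>3" "inc_linear F\<^sub>4"
    and zero_product: "\<And>f g. f * g = 0 \<Longrightarrow> g * f = 0 \<Longrightarrow>
      F\<^sub>1 f * g + f * F\<^sub>2 g + F\<^sub>3 g * f + g * F\<^sub>4 f = 0"
begin

text \<open>The premise is symmetric in \<open>f\<close> and \<open>g\<close>, so every result on
  \<open>F\<^sub>1\<close> and \<open>F\<^sub>2\<close> carries over to \<open>F\<^sub>3\<close> and
  \<open>F\<^sub>4\<close>.\<close>

lemma swap: "zero_product_identity F\<^sub>3 F\<^sub>4 F\<^sub>1 F\<^sub>2"
proof
  fix f g :: "('x, 'r) incidence"
  assume "f * g = 0" "g * f = 0"
  from zero_product[OF this(2,1)] show "F\<^sub>3 f * g + f * F\<^sub>4 g + F\<^sub>1 g * f + g * F\<^sub>2 f = 0"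
    by (simp add: algebra_simps)
qed (use linear in \<open>auto dest: module_hom.add module_hom.scale\<close>)

section \<open>The bilinear form on matrix units\<close>

definition form :: "('x, 'r) incidence \<Rightarrow> ('x, 'r) incidence \<Rightarrow> ('x, 'r) incidence"
  where "form f g = F\<^sub>1 f * g + f * F\<^sub>2 g + F\<^sub>3 g * f + g * F\<^sub>4 f"

lemma form_add_right: "form f (g + g') = form f g + form f g'"
  by (simp add: form_def linear[THEN module_hom.add] algebra_simps)

lemma form_diff_left: "form (f - f') g = form f g - form f' g"
  by (simp add: form_def linear[THEN module_hom.diff] algebra_simps)

text \<open>Each product with a matrix unit is supported in a single row or column, so an entry
  involves at most four coefficients.\<close>

lemma form_munit:
  assumes "x \<le> y" "u \<le> v"
  shows "inc_apply (form (munit x y) (munit u v)) a b =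
    (if b = v then coeff F\<^sub>1 x y a u else 0) + (if a = x then coeff F\<^sub>2 u v y b else 0)
    + (if b = y then coeff F\<^sub>3 u v a x else 0) + (if a = u then coeff F\<^sub>4 x y v b else 0)"
  using assms by (simp add: form_def inc_apply_simps inc_apply_mult_munit inc_apply_munit_mult)

lemma form_orthogonal:
  assumes "x \<le> y" "u \<le> v" "y \<noteq> u" "v \<noteq> x"
  shows "form (munit x y) (munit u v) = 0"
  using assms unfolding form_def by (intro zero_product) (simp_all add: munit_mult_munit)

text \<open>The product of the two chosen elements is \<open>munit x z - munit x z\<close> and the
  reverse product is zero; the mixed terms of the form vanish by
  \<open>form_orthogonal\<close>.\<close>

lemma form_transfer:
  assumes "x < y" "y \<le> z"
  shows "form (munit x y) (munit y z) = form (munit x x) (munit x z)"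
proof -
  have "form (munit x y - munit x x) (munit y z + munit x z) = 0"
    using assms unfolding form_def
    by (intro zero_product) (auto simp: algebra_simps munit_mult_munit)
  then show ?thesis
    using assms by (simp add: form_add_right form_diff_left form_orthogonal)
qed

section \<open>Coefficient identities read off from the form\<close>

lemma coeff_unit_off_diagonal:
  assumes "a \<noteq> x" "b \<noteq> x" "a \<noteq> b"
  shows "coeff F\<^sub>1 x x a b = 0" "coeff F\<^sub>2 x x a b = 0"
proof -
  have "form (munit x x) (munit b b) = 0" "form (munit a a) (munit x x) = 0"
    using assms by (auto intro!: form_orthogonal)
  from arg_cong[OF this(1), of "\<lambda>f. inc_apply f a b"] arg_cong[OF this(2), of "\<lambda>f. inc_apply f a b"]
  show "coeff F\<^sub>1 x x a b = 0" "coeff F\<^sub>2 x x a b = 0"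
    using assms by (simp_all add: form_munit inc_apply_simps)
qed

text \<open>The first identity gives \<open>F\<^sub>1\<close> and \<open>F\<^sub>2\<close> a common
  inner derivation; the others are the source of the opposite signs of the central maps.\<close>

lemma coeff_units:
  assumes "x \<noteq> y"
  shows "coeff F\<^sub>1 x x x y + coeff F\<^sub>2 y y x y = 0"
    and "coeff F\<^sub>1 x x y y + coeff F\<^sub>4 x x y y = 0"
    and "coeff F\<^sub>2 y y x x + coeff F\<^sub>3 y y x x = 0"
proof -
  have *: "form (munit x x) (munit y y) = 0"
    using assms by (auto intro!: form_orthogonal)
  from arg_cong[OF this, of "\<lambda>f. inc_apply f x y"]
  show "coeff F\<^sub>1 x x x y + coeff F\<^sub>2 y y x y = 0"
    using assms by (simp add: form_munit inc_apply_simps)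
  from arg_cong[OF *, of "\<lambda>f. inc_apply f y y"]
  show "coeff F\<^sub>1 x x y y + coeff F\<^sub>4 x x y y = 0"
    using assms by (simp add: form_munit inc_apply_simps)
  from arg_cong[OF *, of "\<lambda>f. inc_apply f x x"]
  show "coeff F\<^sub>2 y y x x + coeff F\<^sub>3 y y x x = 0"
    using assms by (simp add: form_munit inc_apply_simps)
qed

text \<open>As \<open>z\<close> lies off the edge, the units are orthogonal. The third identity will
  compare the diagonal of \<open>F\<^sub>2 (munit z z)\<close> at the two ends of the edge.\<close>

lemma coeff_edge_unit:
  assumes "x < y" "z \<noteq> x" "z \<noteq> y"
  shows "a \<noteq> x \<Longrightarrow> a \<noteq> z \<Longrightarrow> coeff F\<^sub>1 x y a z = 0"
    and "coeff F\<^sub>1 x y x z + coeff F\<^sub>2 z z y z = 0"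
    and "coeff F\<^sub>2 z z y y + coeff F\<^sub>3 z z x x = 0"
    and "coeff F\<^sub>1 x y z z + coeff F\<^sub>4 x y z z = 0"
proof -
  have *: "form (munit x y) (munit z z) = 0"
    using assms by (auto intro!: form_orthogonal)
  show "coeff F\<^sub>1 x y a z = 0" if "a \<noteq> x" "a \<noteq> z"
    using arg_cong[OF *, of "\<lambda>f. inc_apply f a z"] assms that
    by (simp add: form_munit inc_apply_simps)
  show "coeff F\<^sub>1 x y x z + coeff F\<^sub>2 z z y z = 0"
    using arg_cong[OF *, of "\<lambda>f. inc_apply f x z"] assms
    by (simp add: form_munit inc_apply_simps)
  show "coeff F\<^sub>2 z z y y + coeff F\<^sub>3 z z x x = 0"
    using arg_cong[OF *, of "\<lambda>f. inc_apply f x y"] assms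
    by (simp add: form_munit inc_apply_simps)
  show "coeff F\<^sub>1 x y z z + coeff F\<^sub>4 x y z z = 0"
    using arg_cong[OF *, of "\<lambda>f. inc_apply f z z"] assms
    by (simp add: form_munit inc_apply_simps)
qed

lemma coeff_unit_edge:
  assumes "x < y" "z \<noteq> x" "z \<noteq> y"
  shows "b \<noteq> y \<Longrightarrow> b \<noteq> z \<Longrightarrow> coeff F\<^sub>2 x y z b = 0"
    and "coeff F\<^sub>2 x y z y + coeff F\<^sub>1 z z z x = 0"
proof -
  have *: "form (munit z z) (munit x y) = 0"
    using assms by (auto intro!: form_orthogonal)
  show "coeff F\<^sub>2 x y z b = 0" if "b \<noteq> y" "b \<noteq> z"
    using arg_cong[OF *, of "\<lambda>f. inc_apply f z b"] assms that
    by (simp add: form_munit inc_apply_simps)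
  show "coeff F\<^sub>2 x y z y + coeff F\<^sub>1 z z z x = 0"
    using arg_cong[OF *, of "\<lambda>f. inc_apply f z y"] assms
    by (simp add: form_munit inc_apply_simps add.commute)
qed

text \<open>These are entries of \<open>form_transfer\<close> with \<open>z = y\<close>. The last
  one, at \<open>(x, y)\<close>, links the coefficients of \<open>F\<^sub>1\<close> and
  \<open>F\<^sub>2\<close> on which the derivation depends.\<close>

lemma coeff_transfer:
  assumes "x < y"
  shows "a \<noteq> x \<Longrightarrow> a \<noteq> y \<Longrightarrow> coeff F\<^sub>1 x y a y = coeff F\<^sub>1 x x a x"
    and "b \<noteq> x \<Longrightarrow> b \<noteq> y \<Longrightarrow> coeff F\<^sub>2 x y x b = coeff F\<^sub>2 y y y b"
    and "a \<noteq> x \<Longrightarrow> coeff F\<^sub>3 x y a x = 0"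
    and "b \<noteq> y \<Longrightarrow> coeff F\<^sub>4 x y y b = 0"
    and "coeff F\<^sub>2 x y x x + coeff F\<^sub>3 x y x x = 0"
    and "coeff F\<^sub>1 x y y y + coeff F\<^sub>4 x y y y = 0"
    and "coeff F\<^sub>1 x y x y + coeff F\<^sub>2 y y y y + coeff F\<^sub>3 y y x x
      = coeff F\<^sub>1 x x x x + coeff F\<^sub>2 x y x y + coeff F\<^sub>4 x x y y"
proof -
  have lower: "coeff F y y y x = 0" "coeff F x x y x = 0" "coeff F x y y x = 0"
    for F :: "('x, 'r) incidence \<Rightarrow> ('x, 'r) incidence"
    using assms by (auto intro!: inc_apply_eq_0)
  have "form (munit x y) (munit y y) = form (munit x x) (munit x y)"
    using assms by (rule form_transfer) simp
  note * = arg_cong[OF this, of "\<lambda>f. inc_apply f a b" for a b]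
  show "coeff F\<^sub>1 x y a y = coeff F\<^sub>1 x x a x" if "a \<noteq> x" "a \<noteq> y"
    using *[of a y] assms that zero_product_identity.coeff_unit_off_diagonal(1)[OF swap, of a y x]
    by (auto simp: form_munit split: if_splits)
  show "coeff F\<^sub>2 x y x b = coeff F\<^sub>2 y y y b" if "b \<noteq> x" "b \<noteq> y"
    using *[of x b] assms that zero_product_identity.coeff_unit_off_diagonal(2)[OF swap, of y x b]
    by (auto simp: form_munit split: if_splits)
  show "coeff F\<^sub>3 x y a x = 0" if "a \<noteq> x"
    using *[of a x] assms that lower by (auto simp: form_munit split: if_splits)
  show "coeff F\<^sub>4 x y y b = 0" if "b \<noteq> y"
    using *[of y b] assms that lower by (auto simp: form_munit split: if_splits)
  show "coeff F\<^sub>2 x y x x + coeff F\<^sub>3 x y x x = 0"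
    using *[of x x] assms lower by (auto simp: form_munit split: if_splits)
  show "coeff F\<^sub>1 x y y y + coeff F\<^sub>4 x y y y = 0"
    using *[of y y] assms lower by (auto simp: form_munit split: if_splits)
  show "coeff F\<^sub>1 x y x y + coeff F\<^sub>2 y y y y + coeff F\<^sub>3 y y x x
      = coeff F\<^sub>1 x x x x + coeff F\<^sub>2 x y x y + coeff F\<^sub>4 x x y y"
    using *[of x y] assms by (auto simp: form_munit split: if_splits)
qed

text \<open>Consecutive edges are not orthogonal, so \<open>form_transfer\<close> takes over. The
  first identity leads to additivity of \<open>\<sigma>\<close>, the others compare
  diagonals.\<close>

lemma coeff_chain:
  assumes "x < y" "y < z"
  shows "coeff F\<^sub>1 x y x y + coeff F\<^sub>2 y z y z
      = coeff F\<^sub>1 x x x x + coeff F\<^sub>2 x z x z + coeff F\<^sub>4 x x z z"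
    and "coeff F\<^sub>1 x y y y + coeff F\<^sub>4 x y z z = 0"
    and "coeff F\<^sub>2 y z y y + coeff F\<^sub>3 y z x x = 0"
proof -
  have "x < z" "coeff F\<^sub>1 x x y x = 0" "coeff F\<^sub>2 z z z y = 0"
    using assms by (auto intro!: inc_apply_eq_0)
  have *: "form (munit x y) (munit y z) = form (munit x x) (munit x z)"
    using assms by (intro form_transfer) auto
  \<comment> \<open>At \<open>(x, y)\<close> the previous expression still contains the coefficient
    of \<open>F\<^sub>2 (munit x z)\<close>; this one has only an entry below the diagonal.\<close>
  also have "\<dots> = form (munit x z) (munit z z)"
    using \<open>x < z\<close> by (intro form_transfer[symmetric]) auto
  finally have **: "form (munit x y) (munit y z) = form (munit x z) (munit z z)" .
  show "coeff F\<^sub>1 x y x y + coeff F\<^sub>2 y z y z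
      = coeff F\<^sub>1 x x x x + coeff F\<^sub>2 x z x z + coeff F\<^sub>4 x x z z"
    using arg_cong[OF *, of "\<lambda>f. inc_apply f x z"] assms \<open>x < z\<close>
    by (auto simp: form_munit split: if_splits)
  show "coeff F\<^sub>1 x y y y + coeff F\<^sub>4 x y z z = 0"
    using arg_cong[OF *, of "\<lambda>f. inc_apply f y z"] assms \<open>x < z\<close> \<open>coeff F\<^sub>1 x x y x = 0\<close>
    by (auto simp: form_munit split: if_splits)
  show "coeff F\<^sub>2 y z y y + coeff F\<^sub>3 y z x x = 0"
    using arg_cong[OF **, of "\<lambda>f. inc_apply f x y"] assms \<open>x < z\<close> \<open>coeff F\<^sub>2 z z z y = 0\<close>
    by (auto simp: form_munit split: if_splits)
qed

lemma coeff_edge_diagonal_14: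
  assumes "x < y"
  shows "coeff F\<^sub>1 x y z z + coeff F\<^sub>4 x y z z = 0"
proof -
  consider "z = x" | "z = y" | "z \<noteq> x" "z \<noteq> y" by blast
  then show ?thesis
    using coeff_transfer(6)[OF assms] zero_product_identity.coeff_transfer(5)[OF swap assms]
      coeff_edge_unit(4)[OF assms] by cases (auto simp: add.commute)
qed

text \<open>Whether the edges form a chain or have orthogonal units, the value of
  \<open>F\<^sub>1\<close> at \<open>u\<close> is opposite to that of \<open>F\<^sub>4\<close> at
  \<open>v\<close>, which in turn is opposite to that of \<open>F\<^sub>1\<close> at
  \<open>v\<close>.\<close>

lemma coeff_edge_diagonal_step:
  assumes "x < y" "u < v" "(u, v) \<noteq> (x, y)"
  shows "coeff F\<^sub>1 x y u u = coeff F\<^sub>1 x y v v"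
proof -
  interpret swap: zero_product_identity F\<^sub>3 F\<^sub>4 F\<^sub>1 F\<^sub>2
    by (rule swap)
  have "coeff F\<^sub>1 x y u u + coeff F\<^sub>4 x y v v = 0"
  proof -
    consider "y = u" | "v = x" | "y \<noteq> u" "v \<noteq> x" by blast
    then show ?thesis
    proof cases
      case 1
      then show ?thesis
        using assms coeff_chain(2)[of x y v] by simp
    next
      case 2
      then show ?thesis
        using assms swap.coeff_chain(3)[of u x y] by (simp add: add.commute)
    next
      case 3
      have "form (munit x y) (munit u v) = 0"
        using assms 3 by (intro form_orthogonal) auto
      from arg_cong[OF this, of "\<lambda>f. inc_apply f u v"]
      have sum: "coeff F\<^sub>1 x y u u + (if u = x then coeff F\<^sub>2 u v y v else 0)
          + (if v = y then coeff F\<^sub>3 u v u x else 0) + coeff F\<^sub>4 x y v v = 0"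
        using assms by (simp add: form_munit inc_apply_simps)
      \<comment> \<open>A shared lower or upper end adds a term to the entry; it reduces to one of
        these coefficients below the diagonal.\<close>
      have "coeff F\<^sub>1 y y y x = 0" "coeff F\<^sub>4 x x y x = 0"
        using assms by (auto intro!: inc_apply_eq_0)
      then have "coeff F\<^sub>2 u v y v = 0" if "u = x"
        using coeff_unit_edge(2)[of x v y] assms that by auto
      moreover have "coeff F\<^sub>3 u v u x = 0" if "v = y"
        using swap.coeff_edge_unit(2)[of u y x] \<open>coeff F\<^sub>4 x x y x = 0\<close> assms that 3 by auto
      ultimately show ?thesis
        using sum by (auto split: if_splits)
    qed
  qed
  with coeff_edge_diagonal_14[OF assms(1), of v] show ?thesis
    by (metis add_right_cancel)
qed

end

section \<open>Solutions over a poset without cut vertices\<close>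

lemma symp_comparability: "symp comparability"
  by (auto simp: symp_def comparability_def)

lemma irreflp_comparability: "irreflp comparability"
  by (auto simp: irreflp_def comparability_def)

definition other :: "'a \<Rightarrow> 'a"
  where "other x = (SOME y. y \<noteq> x)"

text \<open>The diagonal of \<open>F (munit x y)\<close> turns out to be constant away from the entry \<open>(x, x)\<close>
  when \<open>x = y\<close>, hence the choice of an index different from \<open>x\<close>.\<close>

definition diagonal_part :: "(('x::{finite, order}, 'r::comm_ring_1) incidence \<Rightarrow> ('x, 'r) incidence)
    \<Rightarrow> ('x, 'r) incidence \<Rightarrow> ('x, 'r) incidence"
  where "diagonal_part F f = inc_scale
    (\<Sum>x\<in>UNIV. \<Sum>y\<in>{x..}. inc_apply f x y * coeff F x y (other x) (other x)) 1"

lemma inc_linear_diagonal_part: "inc_linear (diagonal_part F)"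
  by (rule inc_linearI; rule incidence_eqI)
    (simp_all add: diagonal_part_def inc_apply_simps sum.distrib sum_distrib_left algebra_simps)

lemma diagonal_part_in_ring_center: "range (diagonal_part F) \<subseteq> ring_center"
  by (auto simp: diagonal_part_def inc_scale_one_in_ring_center)

lemma diagonal_part_munit:
  assumes "x \<le> y"
  shows "diagonal_part F (munit x y) = inc_scale (coeff F x y (other x) (other x)) 1"
proof -
  have "(\<Sum>v\<in>{u..}. inc_apply (munit x y) u v * coeff F u v (other u) (other u))
      = (if u = x then coeff F x y (other x) (other x) else 0)" for u
  proof -
    have "(\<Sum>v\<in>{u..}. inc_apply (munit x y) u v * coeff F u v (other u) (other u))
        = (\<Sum>v\<in>{u..}. if v = y then (if u = x then coeff F x y (other x) (other x) else 0) else 0)"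
      by (rule sum.cong) (auto simp: munit.rep_eq)
    then show ?thesis
      using assms by auto
  qed
  then show ?thesis
    by (simp add: diagonal_part_def)
qed

locale zero_product_identity_no_cut =
  zero_product_identity F\<^sub>1 F\<^sub>2 F\<^sub>3 F\<^sub>4
  for F\<^sub>1 F\<^sub>2 F\<^sub>3 F\<^sub>4 :: "('x::{finite, order}, 'r::comm_ring_1) incidence \<Rightarrow> ('x, 'r) incidence" +
  assumes no_cut: "no_cut_vertex (comparability :: 'x \<Rightarrow> 'x \<Rightarrow> bool)"
    and card: "card (UNIV :: 'x set) > 2"
begin

lemma swap_no_cut: "zero_product_identity_no_cut F\<^sub>3 F\<^sub>4 F\<^sub>1 F\<^sub>2"
  using swap no_cut card
  by (simp add: zero_product_identity_no_cut_def zero_product_identity_no_cut_axioms_def)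

lemma ex_third: "\<exists>w :: 'x. w \<noteq> x \<and> w \<noteq> y"
proof (rule ccontr)
  assume "\<nexists>w :: 'x. w \<noteq> x \<and> w \<noteq> y"
  then have "card (UNIV :: 'x set) \<le> card {x, y}"
    by (intro card_mono) auto
  also have "\<dots> \<le> 2"
    by (simp add: card_insert_if)
  finally show False
    using card by simp
qed

lemma other_neq: "other (x :: 'x) \<noteq> x"
  unfolding other_def using ex_third[of x x] someI[of "\<lambda>y. y \<noteq> x"] by blast

text \<open>Along an edge avoiding \<open>z\<close>, both values are negatives of the same
  coefficient of \<open>F\<^sub>3\<close>.\<close>

lemma coeff_unit_diagonal_2:
  assumes "x \<noteq> z" "y \<noteq> z"
  shows "coeff F\<^sub>2 z z x x = coeff F\<^sub>2 z z y y"
proof -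
  have step: "coeff F\<^sub>2 z z a a = coeff F\<^sub>2 z z b b" if "a < b" "a \<noteq> z" "b \<noteq> z" for a b
    using coeff_edge_unit(3)[of a b z] coeff_units(3)[of a z] that
    by (metis add_right_cancel)
  have "(adj_avoiding comparability z)\<^sup>*\<^sup>* x y"
    using no_cut assms by (auto simp: no_cut_vertex_def)
  then show ?thesis
    by (induction rule: rtranclp_induct)
      (auto simp: adj_avoiding_def comparability_def dest: step)
qed

lemma coeff_unit_diagonal_1:
  assumes "x \<noteq> z" "y \<noteq> z"
  shows "coeff F\<^sub>1 z z x x = coeff F\<^sub>1 z z y y"
  using coeff_units(2)[of z x] coeff_units(2)[of z y] assms
    zero_product_identity_no_cut.coeff_unit_diagonal_2[OF swap_no_cut assms]
  by (metis add_right_cancel)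

text \<open>Walks must not use the edge between \<open>x\<close> and \<open>y\<close>, which
  deleting either end excludes. Every vertex survives one of the two deletions and is then connected
  to a third vertex \<open>w\<close>.\<close>

lemma coeff_edge_diagonal_1:
  assumes "x < y"
  shows "coeff F\<^sub>1 x y u u = coeff F\<^sub>1 x y v v"
proof -
  have avoid: "coeff F\<^sub>1 x y u u = coeff F\<^sub>1 x y v v" if "z = x \<or> z = y" "u \<noteq> z" "v \<noteq> z" for z u v
  proof -
    have "(adj_avoiding comparability z)\<^sup>*\<^sup>* u v"
      using no_cut that by (auto simp: no_cut_vertex_def)
    then show ?thesis
    proof (induction rule: rtranclp_induct)
      case (step a b)
      have "coeff F\<^sub>1 x y a a = coeff F\<^sub>1 x y b b"
        using step(2) that(1) coeff_edge_diagonal_step[OF assms, of a b]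
          coeff_edge_diagonal_step[OF assms, of b a]
        by (auto simp: adj_avoiding_def comparability_def)
      with step show ?case by simp
    qed simp
  qed
  obtain w where w: "w \<noteq> x" "w \<noteq> y"
    using ex_third[of x y] by blast
  have "coeff F\<^sub>1 x y u u = coeff F\<^sub>1 x y w w" for u
    using avoid[of x u w] avoid[of y u w] w assms by (cases "u = x") auto
  from this[of u] this[of v] show ?thesis by simp
qed

lemma coeff_edge_diagonal_2:
  assumes "x < y"
  shows "coeff F\<^sub>2 x y u u = coeff F\<^sub>2 x y v v"
  using zero_product_identity.coeff_edge_diagonal_14[OF swap assms, of u]
    zero_product_identity.coeff_edge_diagonal_14[OF swap assms, of v]
    zero_product_identity_no_cut.coeff_edge_diagonal_1[OF swap_no_cut assms, of u v]
  by (metis add_left_cancel)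

text \<open>This lets one central map serve \<open>F\<^sub>2\<close> and \<open>F\<^sub>3\<close>
  with opposite signs; the swapped version does so for \<open>F\<^sub>1\<close> and
  \<open>F\<^sub>4\<close>.\<close>

lemma diagonal_part_sum_23: "diagonal_part F\<^sub>2 f + diagonal_part F\<^sub>3 f = 0"
proof -
  have "coeff F\<^sub>2 x y (other x) (other x) + coeff F\<^sub>3 x y (other x) (other x) = 0" if "x \<le> y" for x y
  proof (cases "x = y")
    case True
    then show ?thesis
      using coeff_units(3)[of "other x" x] other_neq by simp
  next
    case False
    then show ?thesis
      using zero_product_identity.coeff_edge_diagonal_14[OF swap, of x y "other x"] that
      by (simp add: add.commute)
  qed
  then have "(\<Sum>x\<in>UNIV. \<Sum>y\<in>{x..}. inc_apply f x y
      * (coeff F\<^sub>2 x y (other x) (other x) + coeff F\<^sub>3 x y (other x) (other x))) = 0"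
    by (intro sum.neutral ballI) simp
  then show ?thesis
    by (simp add: diagonal_part_def sum.distrib distrib_left flip: incidence.scale_left_distrib)
qed

text \<open>The factor by which the derivation rescales \<open>munit x y\<close>: the coefficient of
  \<open>F\<^sub>1\<close> there, less the diagonal entry of the left multiplier at
  \<open>x\<close>.\<close>

definition \<sigma> :: "'x \<Rightarrow> 'x \<Rightarrow> 'r"
  where "\<sigma> x y = (if x < y
    then coeff F\<^sub>1 x y x y - coeff F\<^sub>1 x x x x + coeff F\<^sub>1 x x (other x) (other x) else 0)"

lemma \<sigma>_eq_1:
  "x < y \<Longrightarrow> coeff F\<^sub>1 x y x y = coeff F\<^sub>1 x x x x - coeff F\<^sub>1 x x (other x) (other x) + \<sigma> x y"
  by (simp add: \<sigma>_def)

text \<open>The same \<open>\<sigma>\<close> serves \<open>F\<^sub>2\<close>, so both maps share one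
  derivation: \<open>coeff_transfer\<close> relates them once the diagonals of
  \<open>F\<^sub>3\<close> and \<open>F\<^sub>4\<close> are replaced by their constant
  values.\<close>

lemma \<sigma>_eq_2:
  assumes "x < y"
  shows "coeff F\<^sub>2 x y x y = coeff F\<^sub>2 y y y y - coeff F\<^sub>2 y y (other y) (other y) + \<sigma> x y"
proof -
  have "coeff F\<^sub>3 y y x x = - coeff F\<^sub>2 y y (other y) (other y)"
    using coeff_units(3)[of x y] coeff_unit_diagonal_2[of x y "other y"] other_neq[of y] assms
    by (simp add: eq_neg_iff_add_eq_0 add.commute)
  moreover have "coeff F\<^sub>4 x x y y = - coeff F\<^sub>1 x x (other x) (other x)"
    using coeff_units(2)[of x y] coeff_unit_diagonal_1[of y x "other x"] other_neq[of x] assms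
    by (simp add: eq_neg_iff_add_eq_0 add.commute)
  ultimately show ?thesis
    using coeff_transfer(7)[OF assms] \<sigma>_eq_1[OF assms] by (simp add: algebra_simps)
qed

lemma \<sigma>_additive:
  assumes "x \<le> y" "y \<le> z"
  shows "\<sigma> x z = \<sigma> x y + \<sigma> y z"
proof (cases "x = y \<or> y = z")
  case True
  then show ?thesis
    by (auto simp: \<sigma>_def)
next
  case False
  then have less: "x < y" "y < z" "x < z"
    using assms by (auto simp: order_less_le)
  have "coeff F\<^sub>4 x x z z = - coeff F\<^sub>1 x x (other x) (other x)"
    using coeff_units(2)[of x z] coeff_unit_diagonal_1[of z x "other x"] other_neq[of x] less
    by (simp add: eq_neg_iff_add_eq_0 add.commute)
  then show ?thesis
    using coeff_chain(1)[OF less(1,2)] \<sigma>_eq_1[OF less(1)] \<sigma>_eq_2[OF less(2)] \<sigma>_eq_2[OF less(3)]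
    by (simp add: algebra_simps)
qed

text \<open>The element whose commutator \<open>inner * f - f * inner\<close> is the inner part of
  the derivation.\<close>

lift_definition inner :: "('x, 'r) incidence"
  is "\<lambda>a b. if a < b then - coeff F\<^sub>1 a a a b else 0"
  by auto

text \<open>This is \<open>C\<^sub>1 + inner\<close>, as \<open>right_factor\<close> is
  \<open>C\<^sub>2 - inner\<close>. The diagonal omits the central value, which
  \<open>diagonal_part\<close> contributes.\<close>

lift_definition left_factor :: "('x, 'r) incidence"
  is "\<lambda>a b. if a < b then coeff F\<^sub>1 b b a b
    else if a = b then coeff F\<^sub>1 a a a a - coeff F\<^sub>1 a a (other a) (other a) else 0"
  by auto

lift_definition right_factor :: "('x, 'r) incidence"
  is "\<lambda>a b. if a < b then coeff F\<^sub>2 a a a b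
    else if a = b then coeff F\<^sub>2 a a a a - coeff F\<^sub>2 a a (other a) (other a) else 0"
  by auto

lemma inner_eq: "a \<noteq> b \<Longrightarrow> inc_apply inner a b = - coeff F\<^sub>1 a a a b"
  by (auto simp: inner.rep_eq inc_apply_eq_0 order_less_le)

lemma left_factor_eq: "a \<noteq> b \<Longrightarrow> inc_apply left_factor a b = coeff F\<^sub>1 b b a b"
  by (auto simp: left_factor.rep_eq inc_apply_eq_0 order_less_le)

lemma right_factor_eq: "a \<noteq> b \<Longrightarrow> inc_apply right_factor a b = coeff F\<^sub>2 a a a b"
  by (auto simp: right_factor.rep_eq inc_apply_eq_0 order_less_le)

lemma solution_1_munit:
  assumes "x \<le> y"
  shows "F\<^sub>1 (munit x y) = left_factor * munit x y - munit x y * inner + schur \<sigma> (munit x y)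
    + diagonal_part F\<^sub>1 (munit x y)"
proof (rule incidence_eqI)
  fix a b
  have "coeff F\<^sub>1 x y a b = (if b = y then inc_apply left_factor a x else 0)
    - (if a = x then inc_apply inner y b else 0) + (if a = x \<and> b = y then \<sigma> x y else 0)
    + (if a = b then coeff F\<^sub>1 x y (other x) (other x) else 0)"
  proof (cases "x = y")
    case True
    consider "a = b" "a = x" | "a = b" "a \<noteq> x" | "a \<noteq> b" "b = x" | "a \<noteq> b" "a = x"
      | "a \<noteq> b" "a \<noteq> x" "b \<noteq> x" by blast
    then show ?thesis
    proof cases
      case 1
      then show ?thesis
        using True by (simp add: left_factor.rep_eq inner.rep_eq \<sigma>_def)
    next
      case 2
      then show ?thesis
        using True coeff_unit_diagonal_1[of b x "other x"] other_neq[of x] by simp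
    next
      case 3
      then show ?thesis
        using True by (simp add: left_factor_eq)
    next
      case 4
      then show ?thesis
        using True by (simp add: inner_eq)
    next
      case 5
      then show ?thesis
        using True coeff_unit_off_diagonal(1)[of a x b] by simp
    qed
  next
    case False
    then have less: "x < y"
      using assms by simp
    have lower: "inc_apply left_factor y x = 0" "inc_apply inner y x = 0"
      using less by (auto simp: left_factor.rep_eq inner.rep_eq)
    consider "a = b" | "b = y" "a = x" | "a \<noteq> b" "b = y" "a \<noteq> x" | "b = x" "a \<noteq> x"
      | "b \<noteq> x" "b \<noteq> y" "a = x" | "a \<noteq> b" "b \<noteq> x" "b \<noteq> y" "a \<noteq> x" by blast
    then show ?thesis
    proof cases
      case 1
      then show ?thesis
        using False lower coeff_edge_diagonal_1[OF less, of b "other x"] by auto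
    next
      case 2
      then show ?thesis
        using False \<sigma>_eq_1[OF less] by (simp add: left_factor.rep_eq inner.rep_eq)
    next
      case 3
      then show ?thesis
        using False coeff_transfer(1)[OF less] by (simp add: left_factor_eq)
    next
      case 4
      then show ?thesis
        using False zero_product_identity.coeff_transfer(3)[OF swap less] by simp
    next
      case 5
      then show ?thesis
        using False coeff_edge_unit(2)[OF less, of b] coeff_units(1)[of y b]
        by (simp add: inner_eq) (metis add_right_cancel)
    next
      case 6
      then show ?thesis
        using False coeff_edge_unit(1)[OF less, of b a] by simp
    qed
  qed
  then show "coeff F\<^sub>1 x y a b = inc_apply (left_factor * munit x y - munit x y * inner
      + schur \<sigma> (munit x y) + diagonal_part F\<^sub>1 (munit x y)) a b"
    using assms by (auto simp: diagonal_part_munit inc_apply_simps inc_apply_mult_munit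
        inc_apply_munit_mult)
qed

lemma solution_2_munit:
  assumes "x \<le> y"
  shows "F\<^sub>2 (munit x y) = inner * munit x y + munit x y * right_factor + schur \<sigma> (munit x y)
    + diagonal_part F\<^sub>2 (munit x y)"
proof (rule incidence_eqI)
  fix a b
  have "coeff F\<^sub>2 x y a b = (if b = y then inc_apply inner a x else 0)
    + (if a = x then inc_apply right_factor y b else 0) + (if a = x \<and> b = y then \<sigma> x y else 0)
    + (if a = b then coeff F\<^sub>2 x y (other x) (other x) else 0)"
  proof (cases "x = y")
    case True
    consider "a = b" "a = x" | "a = b" "a \<noteq> x" | "a \<noteq> b" "b = x" | "a \<noteq> b" "a = x"
      | "a \<noteq> b" "a \<noteq> x" "b \<noteq> x" by blast
    then show ?thesis
    proof cases
      case 1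
      then show ?thesis
        using True by (simp add: right_factor.rep_eq inner.rep_eq \<sigma>_def)
    next
      case 2
      then show ?thesis
        using True coeff_unit_diagonal_2[of b x "other x"] other_neq[of x] by simp
    next
      case 3
      then show ?thesis
        using True coeff_units(1)[of a x] by (simp add: inner_eq eq_neg_iff_add_eq_0 add.commute)
    next
      case 4
      then show ?thesis
        using True by (simp add: right_factor_eq)
    next
      case 5
      then show ?thesis
        using True coeff_unit_off_diagonal(2)[of a x b] by simp
    qed
  next
    case False
    then have less: "x < y"
      using assms by simp
    have lower: "inc_apply right_factor y x = 0" "inc_apply inner y x = 0"
      using less by (auto simp: right_factor.rep_eq inner.rep_eq)
    consider "a = b" | "a = x" "b = y" | "a \<noteq> b" "a = x" "b \<noteq> y" | "a = y" "b \<noteq> y"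
      | "a \<noteq> x" "a \<noteq> y" "b = y" | "a \<noteq> b" "a \<noteq> x" "a \<noteq> y" "b \<noteq> y" by blast
    then show ?thesis
    proof cases
      case 1
      then show ?thesis
        using False lower coeff_edge_diagonal_2[OF less, of b "other x"] by auto
    next
      case 2
      then show ?thesis
        using False \<sigma>_eq_2[OF less] by (simp add: right_factor.rep_eq inner.rep_eq)
    next
      case 3
      then show ?thesis
        using False coeff_transfer(2)[OF less] by (simp add: right_factor_eq)
    next
      case 4
      then show ?thesis
        using False zero_product_identity.coeff_transfer(4)[OF swap less] by simp
    next
      case 5
      then show ?thesis
        using False coeff_unit_edge(2)[OF less, of a]
        by (simp add: inner_eq eq_neg_iff_add_eq_0)
    next
      case 6
      then show ?thesis
        using False coeff_unit_edge(1)[OF less, of a b] by simp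
    qed
  qed
  then show "coeff F\<^sub>2 x y a b = inc_apply (inner * munit x y + munit x y * right_factor
      + schur \<sigma> (munit x y) + diagonal_part F\<^sub>2 (munit x y)) a b"
    using assms by (auto simp: diagonal_part_munit inc_apply_simps inc_apply_mult_munit
        inc_apply_munit_mult)
qed

lemma solution:
  "\<exists>C\<^sub>1 C\<^sub>2 D. inc_derivation D \<and> (\<forall>f. F\<^sub>1 f = C\<^sub>1 * f + D f + diagonal_part F\<^sub>1 f
    \<and> F\<^sub>2 f = f * C\<^sub>2 + D f + diagonal_part F\<^sub>2 f)"
proof -
  let ?D = "\<lambda>f. inner * f - f * inner + schur \<sigma> f"
  note intros = inc_linear_add inc_linear_diff inc_linear_mult_left inc_linear_mult_right
    inc_linear_schur inc_linear_diagonal_part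
  have "F\<^sub>1 f = left_factor * f - f * inner + schur \<sigma> f + diagonal_part F\<^sub>1 f" for f
    by (rule inc_linear_eqI[OF linear(1)]) (intro intros, rule solution_1_munit)
  \<comment> \<open>Shifting \<open>inner\<close> between multiplier and commutator, here on the
    left and below on the right, produces the same \<open>?D\<close> in both formulas.\<close>
  then have "F\<^sub>1 f = (left_factor - inner) * f + ?D f + diagonal_part F\<^sub>1 f" for f
    by (simp add: algebra_simps)
  moreover have "F\<^sub>2 f = inner * f + f * right_factor + schur \<sigma> f + diagonal_part F\<^sub>2 f" for f
    by (rule inc_linear_eqI[OF linear(2)]) (intro intros, rule solution_2_munit)
  then have "F\<^sub>2 f = f * (right_factor + inner) + ?D f + diagonal_part F\<^sub>2 f" for f
    by (simp add: algebra_simps)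
  moreover have "inc_derivation ?D"
    by (rule inc_derivation_commutator_schur) (rule \<sigma>_additive)
  ultimately show ?thesis
    by blast
qed

end

section \<open>The equivalence\<close>

lemma proper_solutions_imp_no_cut_vertex:
  assumes two: "(2 :: 'r::comm_ring_1) dvd 1"
    and conn: "graph_connected (comparability :: 'x::{finite, order} \<Rightarrow> 'x \<Rightarrow> bool)"
    and proper: "\<And>F\<^sub>1 F\<^sub>2 F\<^sub>3 F\<^sub>4 :: ('x, 'r) incidence \<Rightarrow> ('x, 'r) incidence.
      zero_product_identity F\<^sub>1 F\<^sub>2 F\<^sub>3 F\<^sub>4 \<Longrightarrow> \<exists>C\<^sub>1 C\<^sub>2 D \<Omega>\<^sub>1 \<Omega>\<^sub>2.
        range \<Omega>\<^sub>1 \<subseteq> ring_center \<and> range \<Omega>\<^sub>2 \<subseteq> ring_center \<and>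
        (\<forall>f. F\<^sub>1 f = C\<^sub>1 * f + D f + \<Omega>\<^sub>1 f \<and> F\<^sub>2 f = f * C\<^sub>2 + D f + \<Omega>\<^sub>2 f)"
  shows "no_cut_vertex (comparability :: 'x \<Rightarrow> 'x \<Rightarrow> bool)"
  unfolding no_cut_vertex_def
proof (intro allI impI, rule ccontr)
  fix p x y :: 'x assume ne: "x \<noteq> p" "y \<noteq> p"
    and not_reach: "\<not> (adj_avoiding comparability p)\<^sup>*\<^sup>* x y"
  let ?R = "adj_avoiding (comparability :: 'x \<Rightarrow> 'x \<Rightarrow> bool) p"
  \<comment> \<open>The components of the poset without \<open>p\<close>, other than that of
    \<open>x\<close>; edges leave their union only towards \<open>p\<close>.\<close>
  define W where "W = {w. w \<noteq> p \<and> \<not> ?R\<^sup>*\<^sup>* x w}"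
  have W: "p \<notin> W" "y \<in> W" "x \<notin> W"
    using ne not_reach by (auto simp: W_def)
  have boundary: "b = p" if "a \<in> W" "b \<notin> W" "comparability a b" for a b
  proof (rule ccontr)
    assume "b \<noteq> p"
    then have "?R\<^sup>*\<^sup>* x b" "?R b a"
      using that by (auto simp: W_def adj_avoiding_def comparability_def)
    then show False
      using that by (auto simp: W_def intro: rtranclp.rtrancl_into_rtrancl)
  qed
  let ?F = "cut_map p W :: ('x, 'r) incidence \<Rightarrow> ('x, 'r) incidence"
  have "zero_product_identity ?F (\<lambda>f. - ?F f) ?F (\<lambda>f. - ?F f)"
  proof
    fix f g
    show "?F f * g + f * (- ?F g) + ?F g * f + g * (- ?F f) = 0"
      by (rule cut_map_commuting[OF W(1)]) (erule boundary, assumption+)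
  qed (simp_all add: module_hom.add[OF inc_linear_cut_map] module_hom.scale[OF inc_linear_cut_map])
  from proper[OF this] obtain C\<^sub>1 C\<^sub>2 D \<Omega>\<^sub>1 \<Omega>\<^sub>2
    where sol: "range \<Omega>\<^sub>1 \<subseteq> ring_center \<and> range \<Omega>\<^sub>2 \<subseteq> ring_center \<and>
      (\<forall>f. ?F f = C\<^sub>1 * f + D f + \<Omega>\<^sub>1 f \<and> - ?F f = f * C\<^sub>2 + D f + \<Omega>\<^sub>2 f)"
    by (elim exE) (rule that)
  then have center: "\<Omega>\<^sub>1 f \<in> ring_center" "\<Omega>\<^sub>2 f \<in> ring_center" for f
    by auto
  show False
    by (rule cut_map_improper[OF two conn W ne(1) _ _ center])
      (rule sol[THEN conjunct2, THEN conjunct2, THEN spec, THEN conjunct1]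
        sol[THEN conjunct2, THEN conjunct2, THEN spec, THEN conjunct2])+
qed

theorem theorem4p7:
  assumes "(2 :: 'r::comm_ring_1) dvd 1"
    and "graph_connected (comparability :: 'x::{finite, order} \<Rightarrow> 'x \<Rightarrow> bool)"
    and "card (UNIV :: 'x set) > 2"
  shows "(\<forall>e \<in> graph_edges (comparability :: 'x \<Rightarrow> 'x \<Rightarrow> bool).
            \<forall>e' \<in> graph_edges (comparability :: 'x \<Rightarrow> 'x \<Rightarrow> bool).
              e \<noteq> e' \<longrightarrow>
              (\<exists>xs. graph_cycle comparability xs \<and> e \<in> cycle_edges xs \<and> e' \<in> cycle_edges xs))
         \<longleftrightarrow>
         (\<forall>F\<^sub>1 F\<^sub>2 F\<^sub>3 F\<^sub>4 :: ('x, 'r) incidence \<Rightarrow> ('x, 'r) incidence.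
            inc_linear F\<^sub>1 \<and> inc_linear F\<^sub>2 \<and> inc_linear F\<^sub>3 \<and> inc_linear F\<^sub>4 \<and>
            (\<forall>f g. f * g = 0 \<and> g * f = 0 \<longrightarrow>
               F\<^sub>1 f * g + f * F\<^sub>2 g + F\<^sub>3 g * f + g * F\<^sub>4 f = 0) \<longrightarrow>
            (\<exists>C\<^sub>1 C\<^sub>2 C\<^sub>3 C\<^sub>4 D\<^sub>1 D\<^sub>2 \<Omega>\<^sub>1 \<Omega>\<^sub>2.
               inc_derivation D\<^sub>1 \<and> inc_derivation D\<^sub>2 \<and>
               inc_linear \<Omega>\<^sub>1 \<and> range \<Omega>\<^sub>1 \<subseteq> ring_center \<and>
               inc_linear \<Omega>\<^sub>2 \<and> range \<Omega>\<^sub>2 \<subseteq> ring_center \<and>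
               (\<forall>f. F\<^sub>1 f = C\<^sub>1 * f + D\<^sub>1 f + \<Omega>\<^sub>1 f \<and>
                    F\<^sub>2 f = f * C\<^sub>2 + D\<^sub>1 f + \<Omega>\<^sub>2 f \<and>
                    F\<^sub>3 f = C\<^sub>3 * f + D\<^sub>2 f - \<Omega>\<^sub>2 f \<and>
                    F\<^sub>4 f = f * C\<^sub>4 + D\<^sub>2 f - \<Omega>\<^sub>1 f)))"
    (is "?cycles \<longleftrightarrow> ?proper")
proof
  assume cycles: ?cycles
  have no_cut: "no_cut_vertex (comparability :: 'x \<Rightarrow> 'x \<Rightarrow> bool)"
    by (rule no_cut_vertexI[OF symp_comparability assms(2) cycles])
  show ?proper
  proof (intro allI impI)
    fix F\<^sub>1 F\<^sub>2 F\<^sub>3 F\<^sub>4 :: "('x, 'r) incidence \<Rightarrow> ('x, 'r) incidence"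
    assume "inc_linear F\<^sub>1 \<and> inc_linear F\<^sub>2 \<and> inc_linear F\<^sub>3 \<and> inc_linear F\<^sub>4 \<and>
      (\<forall>f g. f * g = 0 \<and> g * f = 0 \<longrightarrow>
        F\<^sub>1 f * g + f * F\<^sub>2 g + F\<^sub>3 g * f + g * F\<^sub>4 f = 0)"
    then interpret zero_product_identity_no_cut F\<^sub>1 F\<^sub>2 F\<^sub>3 F\<^sub>4
      using no_cut assms(3)
      by (simp add: zero_product_identity_no_cut_def zero_product_identity_no_cut_axioms_def
          zero_product_identity_def)
    interpret swap: zero_product_identity_no_cut F\<^sub>3 F\<^sub>4 F\<^sub>1 F\<^sub>2
      by (rule swap_no_cut)
    obtain C\<^sub>1 C\<^sub>2 D\<^sub>1 where 1: "inc_derivation D\<^sub>1"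
      "\<And>f. F\<^sub>1 f = C\<^sub>1 * f + D\<^sub>1 f + diagonal_part F\<^sub>1 f"
      "\<And>f. F\<^sub>2 f = f * C\<^sub>2 + D\<^sub>1 f + diagonal_part F\<^sub>2 f"
      using solution by blast
    obtain C\<^sub>3 C\<^sub>4 D\<^sub>2 where 2: "inc_derivation D\<^sub>2"
      "\<And>f. F\<^sub>3 f = C\<^sub>3 * f + D\<^sub>2 f + diagonal_part F\<^sub>3 f"
      "\<And>f. F\<^sub>4 f = f * C\<^sub>4 + D\<^sub>2 f + diagonal_part F\<^sub>4 f"
      using swap.solution by blast
    have "diagonal_part F\<^sub>3 f = - diagonal_part F\<^sub>2 f" "diagonal_part F\<^sub>4 f = - diagonal_part F\<^sub>1 f" for f
      using diagonal_part_sum_23[of f] swap.diagonal_part_sum_23[of f]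
      by (simp_all add: eq_neg_iff_add_eq_0 add.commute)
    then have 3: "F\<^sub>3 f = C\<^sub>3 * f + D\<^sub>2 f - diagonal_part F\<^sub>2 f"
      "F\<^sub>4 f = f * C\<^sub>4 + D\<^sub>2 f - diagonal_part F\<^sub>1 f" for f
      using 2(2)[of f] 2(3)[of f] by simp_all
    show "\<exists>C\<^sub>1 C\<^sub>2 C\<^sub>3 C\<^sub>4 D\<^sub>1 D\<^sub>2 \<Omega>\<^sub>1 \<Omega>\<^sub>2.
        inc_derivation D\<^sub>1 \<and> inc_derivation D\<^sub>2 \<and>
        inc_linear \<Omega>\<^sub>1 \<and> range \<Omega>\<^sub>1 \<subseteq> ring_center \<and>
        inc_linear \<Omega>\<^sub>2 \<and> range \<Omega>\<^sub>2 \<subseteq> ring_center \<and>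
        (\<forall>f. F\<^sub>1 f = C\<^sub>1 * f + D\<^sub>1 f + \<Omega>\<^sub>1 f \<and> F\<^sub>2 f = f * C\<^sub>2 + D\<^sub>1 f + \<Omega>\<^sub>2 f \<and>
          F\<^sub>3 f = C\<^sub>3 * f + D\<^sub>2 f - \<Omega>\<^sub>2 f \<and> F\<^sub>4 f = f * C\<^sub>4 + D\<^sub>2 f - \<Omega>\<^sub>1 f)"
      by (rule exI[of _ C\<^sub>1], rule exI[of _ C\<^sub>2], rule exI[of _ C\<^sub>3], rule exI[of _ C\<^sub>4],
          rule exI[of _ D\<^sub>1], rule exI[of _ D\<^sub>2],
          rule exI[of _ "diagonal_part F\<^sub>1"], rule exI[of _ "diagonal_part F\<^sub>2"], intro conjI allI)
        (fact 1 2(1) 3 inc_linear_diagonal_part diagonal_part_in_ring_center)+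
  qed
next
  assume proper: ?proper
  have "no_cut_vertex (comparability :: 'x \<Rightarrow> 'x \<Rightarrow> bool)"
  proof (rule proper_solutions_imp_no_cut_vertex[OF assms(1,2)])
    fix F\<^sub>1 F\<^sub>2 F\<^sub>3 F\<^sub>4 :: "('x, 'r) incidence \<Rightarrow> ('x, 'r) incidence"
    assume "zero_product_identity F\<^sub>1 F\<^sub>2 F\<^sub>3 F\<^sub>4"
    then have "inc_linear F\<^sub>1 \<and> inc_linear F\<^sub>2 \<and> inc_linear F\<^sub>3 \<and> inc_linear F\<^sub>4 \<and>
      (\<forall>f g. f * g = 0 \<and> g * f = 0 \<longrightarrow>
        F\<^sub>1 f * g + f * F\<^sub>2 g + F\<^sub>3 g * f + g * F\<^sub>4 f = 0)"
      by (simp add: zero_product_identity_def)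
    from proper[rule_format, OF this] obtain C\<^sub>1 C\<^sub>2 C\<^sub>3 C\<^sub>4 D\<^sub>1 D\<^sub>2 \<Omega>\<^sub>1 \<Omega>\<^sub>2
      where sol: "inc_derivation D\<^sub>1 \<and> inc_derivation D\<^sub>2 \<and>
        inc_linear \<Omega>\<^sub>1 \<and> range \<Omega>\<^sub>1 \<subseteq> ring_center \<and>
        inc_linear \<Omega>\<^sub>2 \<and> range \<Omega>\<^sub>2 \<subseteq> ring_center \<and>
        (\<forall>f. F\<^sub>1 f = C\<^sub>1 * f + D\<^sub>1 f + \<Omega>\<^sub>1 f \<and> F\<^sub>2 f = f * C\<^sub>2 + D\<^sub>1 f + \<Omega>\<^sub>2 f \<and>
          F\<^sub>3 f = C\<^sub>3 * f + D\<^sub>2 f - \<Omega>\<^sub>2 f \<and> F\<^sub>4 f = f * C\<^sub>4 + D\<^sub>2 f - \<Omega>\<^sub>1 f)"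
      by (elim exE) (rule that)
    show "\<exists>C\<^sub>1 C\<^sub>2 D \<Omega>\<^sub>1 \<Omega>\<^sub>2. range \<Omega>\<^sub>1 \<subseteq> ring_center \<and> range \<Omega>\<^sub>2 \<subseteq> ring_center \<and>
        (\<forall>f. F\<^sub>1 f = C\<^sub>1 * f + D f + \<Omega>\<^sub>1 f \<and> F\<^sub>2 f = f * C\<^sub>2 + D f + \<Omega>\<^sub>2 f)"
      by (rule exI[of _ C\<^sub>1], rule exI[of _ C\<^sub>2], rule exI[of _ D\<^sub>1],
          rule exI[of _ \<Omega>\<^sub>1], rule exI[of _ \<Omega>\<^sub>2]) (use sol in simp)
  qed
  then show ?cycles
    using no_cut_vertex_common_cycle[OF _ symp_comparability irreflp_comparability assms(2)] by blast
qed

end
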